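(* Let $\alpha$ and $\beta$ be fixed partitions and $n,m$ fixed nonnegative integers. The map $\Phi$ (skew domino Schensted map, defined in the context) is well defined on the set $$\bigcup_{j\geq0}\ \bigcup_{\substack{\mu:\ \beta/\mu\vdash 2(m-j)\\ \alpha/\mu\vdash 2(n-j)}} \mathcal{D}(\beta/\mu)\times\mathcal{D}(\alpha/\mu)\times\mathfrak{M}_{n,m}^j$$ and is a bijection from this set onto $$\bigcup_{\substack{\lambda:\ \lambda/\alpha\vdash 2m\\ \lambda/\beta\vdash 2n}} \mathcal{D}(\lambda/\alpha)\times\mathcal{D}(\lambda/\beta).$$
   Context: Partitions are identified with Young diagrams (cell $(i,j)$ in row $i$, column $j$). For partitions $\mu\subseteq\lambda$, the skew shape $\lambda/\mu$ is the set of cells of $\lambda$ not in $\mu$; $\lambda/\mu\vdash n$ means $\mu\subseteq\lambda$ and $\lambda/\mu$ has $n$ cells. A domino is a pair of horizontally or vertically adjacent cells. A standard domino tableau (SDT) of shape $\lambda/\mu\vdash 2n$ is a bijection $T$ from the cells of $\lambda/\mu$ to $\{1,\dots,2n\}$ with $T(i,j)\le T(i',j')$ whenever $i\le i'$, $j\le j'$, such that for each $k$ the cells with entries $2k-1,2k$ form a domino; it is viewed as dominoes labelled $1,\dots,n$. $\mathcal{D}(\lambda/\mu)$ is the set of SDTs of shape $\lambda/\mu$. Write $\mu<_{\rm d}\lambda$ if $\mu\subset\lambda$ and $\lambda/\mu$ is a domino, and $\mu\le_{\rm d}\lambda$ if $\mu=\lambda$ or $\mu<_{\rm d}\lambda$.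 An $n\times m$ partial permutation matrix (PPM) is an $n\times m$ matrix with entries in $\{1,-1,0\}$ with at most one nonzero entry in each row and column; $\mathfrak{M}_{n,m}^j$ is the set of those with exactly $j$ nonzero entries. Definition of $\Phi$: given $U\in\mathcal{D}(\beta/\mu)$ ($\beta/\mu\vdash2(m-j)$), $V\in\mathcal{D}(\alpha/\mu)$ ($\alpha/\mu\vdash 2(n-j)$) and $M\in\mathfrak{M}^j_{n,m}$, build partitions $\Gamma_{(i,k)}$, $0\le i\le n$, $0\le k\le m$. The top row $\Gamma_{(0,0)}\le_{\rm d}\cdots\le_{\rm d}\Gamma_{(0,m)}$ is the multichain from $\mu$ to $\beta$ with $\Gamma_{(0,k-1)}=\Gamma_{(0,k)}$ exactly when column $k$ of $M$ has a nonzero entry, whose nonempty successive differences are the dominoes of $U$ labelled $1,2,\dots$ in order. The left column $\Gamma_{(0,0)}\le_{\rm d}\cdots\le_{\rm d}\Gamma_{(n,0)}$ is the multichain from $\mu$ to $\alpha$ with $\Gamma_{(i-1,0)}=\Gamma_{(i,0)}$ exactly when row $i$ of $M$ has a nonzero entry, its nonempty differences being the dominoes of $V$ in order. The other entries are determined by the local rules: for $1\le i\le n$, $1\le k\le m$, with $\nu=\Gamma_{(i-1,k-1)}$, $\kappa=\Gamma_{(i-1,k)}$, $\rho=\Gamma_{(i,k-1)}$, the partition $\Gamma_{(i,k)}$ is: (1) if $M(i,k)=1$ (then $\nu=\kappa=\rho$), $\kappa$ with a horizontal domino added to the first row; (2) if $M(i,k)=-1$ (then $\nu=\kappa=\rho$),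 $\kappa$ with a vertical domino added to the first column; (3) if $M(i,k)=0$: (a) if $\nu=\kappa$ or $\nu=\rho$, the largest of $\nu,\kappa,\rho$; (b) if $\nu<_{\rm d}\kappa$, $\nu<_{\rm d}\rho$, $\kappa\ne\rho$ and $\kappa/\nu\cap\rho/\nu=\emptyset$, then $\kappa\cup\rho$; (c) if $\nu<_{\rm d}\kappa$, $\nu<_{\rm d}\rho$, $\kappa\neq\rho$ and $\kappa/\nu\cap\rho/\nu\ne\emptyset$, these share exactly one cell $(p,q)$ and the result is $\kappa\cup\rho$ with the cell $(p+1,q+1)$ added; (d) if $\nu<_{\rm d}\kappa=\rho$ and $\kappa/\nu$ is a horizontal domino in row $r$, then $\kappa$ with a horizontal domino added in row $r+1$; (e) if $\nu<_{\rm d}\kappa=\rho$ and $\kappa/\nu$ is a vertical domino in column $c$, then $\kappa$ with a vertical domino added in column $c+1$. With $\lambda=\Gamma_{(n,m)}$, let $P$ be the SDT of shape $\lambda/\alpha$ whose domino labelled $k$ is $\Gamma_{(n,k)}/\Gamma_{(n,k-1)}$ ($k=1,\dots,m$) and $Q$ the SDT of shape $\lambda/\beta$ whose domino labelled $i$ is $\Gamma_{(i,m)}/\Gamma_{(i-1,m)}$ ($i=1,\dots,n$). Then $\Phi(U,V,M)=(P,Q)$. *)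

theory Defs
  imports Main
begin

type_synonym cell = "nat \<times> nat"
type_synonym diagram = "cell set"

text \<open>Partitions are identified with their Young diagrams: \<open>(i, j)\<close> is the cell in row \<open>i\<close>,
  column \<open>j\<close>, with rows and columns numbered from 1.\<close>

definition is_partition :: "diagram \<Rightarrow> bool" where
  "is_partition l \<longleftrightarrow> finite l \<and>
     (\<forall>(i, j) \<in> l. 1 \<le> i \<and> 1 \<le> j) \<and>
     (\<forall>(i, j) \<in> l. \<forall>i' j'. 1 \<le> i' \<and> i' \<le> i \<and> 1 \<le> j' \<and> j' \<le> j \<longrightarrow> (i', j') \<in> l)"

definition skew_of_size :: "diagram \<Rightarrow> diagram \<Rightarrow> nat \<Rightarrow> bool" where
  "skew_of_size l mu N \<longleftrightarrow>
     is_partition l \<and> is_partition mu \<and> mu \<subseteq> l \<and> card (l - mu) = N"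

definition horizontal_domino :: "nat \<Rightarrow> diagram \<Rightarrow> bool" where
  "horizontal_domino r D \<longleftrightarrow> (\<exists>j. D = {(r, j), (r, j + 1)})"

definition vertical_domino :: "nat \<Rightarrow> diagram \<Rightarrow> bool" where
  "vertical_domino c D \<longleftrightarrow> (\<exists>i. D = {(i, c), (i + 1, c)})"

definition is_domino :: "diagram \<Rightarrow> bool" where
  "is_domino D \<longleftrightarrow> (\<exists>r. horizontal_domino r D) \<or> (\<exists>c. vertical_domino c D)"

text \<open>The cells with entries \<open>2k-1\<close> and \<open>2k\<close>, i.e. the domino labelled \<open>k\<close> (for \<open>k \<ge> 1\<close>).\<close>

definition domino_of :: "(cell \<Rightarrow> nat) \<Rightarrow> nat \<Rightarrow> diagram" where
  "domino_of T k = {c. T c = 2 * k - 1 \<or> T c = 2 * k}"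

text \<open>The standard domino tableaux of shape \<open>l / mu\<close>. A tableau takes the value 0 off its shape;
  as its entries are positive, the function determines the set of cells of the shape.\<close>

definition SDT :: "diagram \<Rightarrow> diagram \<Rightarrow> (cell \<Rightarrow> nat) set" where
  "SDT l mu = {T. \<exists>n. skew_of_size l mu (2 * n) \<and>
     bij_betw T (l - mu) {1..2 * n} \<and>
     (\<forall>c. c \<notin> l - mu \<longrightarrow> T c = 0) \<and>
     (\<forall>(i, j) \<in> l - mu. \<forall>(i', j') \<in> l - mu. i \<le> i' \<and> j \<le> j' \<longrightarrow> T (i, j) \<le> T (i', j')) \<and>
     (\<forall>k \<in> {1..n}. is_domino (domino_of T k))}"

definition less_d :: "diagram \<Rightarrow> diagram \<Rightarrow> bool"  (infix \<open><\<^sub>d\<close> 50) where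
  "mu <\<^sub>d l \<longleftrightarrow> is_partition mu \<and> is_partition l \<and> mu \<subset> l \<and> is_domino (l - mu)"

definition le_d :: "diagram \<Rightarrow> diagram \<Rightarrow> bool"  (infix \<open>\<le>\<^sub>d\<close> 50) where
  "mu \<le>\<^sub>d l \<longleftrightarrow> mu = l \<or> mu <\<^sub>d l"

text \<open>The \<open>n \<times> m\<close> partial permutation matrices with \<open>j\<close> nonzero entries. Matrices are indexed from 1
  and extended by 0.\<close>

definition PPM :: "nat \<Rightarrow> nat \<Rightarrow> nat \<Rightarrow> (nat \<Rightarrow> nat \<Rightarrow> int) set" where
  "PPM n m j = {M.
     (\<forall>i k. M i k \<in> {1, -1, 0}) \<and>
     (\<forall>i k. \<not> (i \<in> {1..n} \<and> k \<in> {1..m}) \<longrightarrow> M i k = 0) \<and>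
     (\<forall>i k k'. M i k \<noteq> 0 \<and> M i k' \<noteq> 0 \<longrightarrow> k = k') \<and>
     (\<forall>i i' k. M i k \<noteq> 0 \<and> M i' k \<noteq> 0 \<longrightarrow> i = i') \<and>
     card {(i, k). M i k \<noteq> 0} = j}"

definition add_horizontal :: "diagram \<Rightarrow> nat \<Rightarrow> diagram" where
  "add_horizontal l r = (let a = card {j. (r, j) \<in> l} in l \<union> {(r, a + 1), (r, a + 2)})"

definition add_vertical :: "diagram \<Rightarrow> nat \<Rightarrow> diagram" where
  "add_vertical l c = (let a = card {i. (i, c) \<in> l} in l \<union> {(a + 1, c), (a + 2, c)})"

text \<open>\<open>local_rule x \<nu> \<kappa> \<rho> \<tau>\<close>: with matrix entry \<open>x\<close>, upper left corner \<open>\<nu>\<close>, upper right corner \<open>\<kappa>\<close> and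
  lower left corner \<open>\<rho>\<close>, the rules produce the lower right corner \<open>\<tau>\<close>. Since this is a relation, it
  is not built in that some rule applies to given data or that \<open>\<tau>\<close> is a partition.\<close>

inductive local_rule :: "int \<Rightarrow> diagram \<Rightarrow> diagram \<Rightarrow> diagram \<Rightarrow> diagram \<Rightarrow> bool" where
  rule_1: "\<nu> = \<kappa> \<Longrightarrow> \<kappa> = \<rho> \<Longrightarrow> local_rule 1 \<nu> \<kappa> \<rho> (add_horizontal \<kappa> 1)"
| rule_2: "\<nu> = \<kappa> \<Longrightarrow> \<kappa> = \<rho> \<Longrightarrow> local_rule (-1) \<nu> \<kappa> \<rho> (add_vertical \<kappa> 1)"
| rule_3a: "\<nu> = \<kappa> \<or> \<nu> = \<rho> \<Longrightarrow> \<tau> \<in> {\<nu>, \<kappa>, \<rho>} \<Longrightarrow> \<nu> \<subseteq> \<tau> \<Longrightarrow> \<kappa> \<subseteq> \<tau> \<Longrightarrow> \<rho> \<subseteq> \<tau> \<Longrightarrow>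
    local_rule 0 \<nu> \<kappa> \<rho> \<tau>"
| rule_3b: "\<nu> <\<^sub>d \<kappa> \<Longrightarrow> \<nu> <\<^sub>d \<rho> \<Longrightarrow> \<kappa> \<noteq> \<rho> \<Longrightarrow> (\<kappa> - \<nu>) \<inter> (\<rho> - \<nu>) = {} \<Longrightarrow>
    local_rule 0 \<nu> \<kappa> \<rho> (\<kappa> \<union> \<rho>)"
| rule_3c: "\<nu> <\<^sub>d \<kappa> \<Longrightarrow> \<nu> <\<^sub>d \<rho> \<Longrightarrow> \<kappa> \<noteq> \<rho> \<Longrightarrow> (\<kappa> - \<nu>) \<inter> (\<rho> - \<nu>) = {(p, q)} \<Longrightarrow>
    local_rule 0 \<nu> \<kappa> \<rho> (\<kappa> \<union> \<rho> \<union> {(p + 1, q + 1)})"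
| rule_3d: "\<nu> <\<^sub>d \<kappa> \<Longrightarrow> \<kappa> = \<rho> \<Longrightarrow> horizontal_domino r (\<kappa> - \<nu>) \<Longrightarrow>
    local_rule 0 \<nu> \<kappa> \<rho> (add_horizontal \<kappa> (r + 1))"
| rule_3e: "\<nu> <\<^sub>d \<kappa> \<Longrightarrow> \<kappa> = \<rho> \<Longrightarrow> vertical_domino c (\<kappa> - \<nu>) \<Longrightarrow>
    local_rule 0 \<nu> \<kappa> \<rho> (add_vertical \<kappa> (c + 1))"

text \<open>\<open>C 0 \<le>\<^sub>d \<dots> \<le>\<^sub>d C N\<close> is a multichain from \<open>mu\<close> to \<open>l\<close> whose \<open>k\<close>-th step is trivial exactly when
  \<open>k \<in> Z\<close>, and whose nontrivial steps are the dominoes of \<open>T\<close> in order.\<close>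

definition domino_multichain ::
  "diagram \<Rightarrow> diagram \<Rightarrow> nat \<Rightarrow> nat set \<Rightarrow> (cell \<Rightarrow> nat) \<Rightarrow> (nat \<Rightarrow> diagram) \<Rightarrow> bool" where
  "domino_multichain mu l N Z T C \<longleftrightarrow> C 0 = mu \<and> C N = l \<and>
     (\<forall>k \<in> {1..N}. C (k - 1) \<le>\<^sub>d C k \<and> (C (k - 1) = C k \<longleftrightarrow> k \<in> Z) \<and>
        (k \<notin> Z \<longrightarrow> C k - C (k - 1) = domino_of T (card ({1..k} - Z))))"

text \<open>The array \<open>\<Gamma>\<close> has indices \<open>0 \<le> i \<le> n\<close>, \<open>0 \<le> k \<le> m\<close>; it is extended by the empty set.\<close>

definition growth_array ::
  "nat \<Rightarrow> nat \<Rightarrow> diagram \<Rightarrow> diagram \<Rightarrow> diagram \<Rightarrow> (cell \<Rightarrow> nat) \<Rightarrow> (cell \<Rightarrow> nat) \<Rightarrow>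
   (nat \<Rightarrow> nat \<Rightarrow> int) \<Rightarrow> (nat \<Rightarrow> nat \<Rightarrow> diagram) \<Rightarrow> bool" where
  "growth_array n m \<alpha> \<beta> \<mu> U V M \<Gamma> \<longleftrightarrow>
     (\<forall>i k. i \<le> n \<and> k \<le> m \<longrightarrow> is_partition (\<Gamma> i k)) \<and>
     (\<forall>i k. \<not> (i \<le> n \<and> k \<le> m) \<longrightarrow> \<Gamma> i k = {}) \<and>
     domino_multichain \<mu> \<beta> m {k. \<exists>i. M i k \<noteq> 0} U (\<lambda>k. \<Gamma> 0 k) \<and>
     domino_multichain \<mu> \<alpha> n {i. \<exists>k. M i k \<noteq> 0} V (\<lambda>i. \<Gamma> i 0) \<and>
     (\<forall>i \<in> {1..n}. \<forall>k \<in> {1..m}.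
        local_rule (M i k) (\<Gamma> (i - 1) (k - 1)) (\<Gamma> (i - 1) k) (\<Gamma> i (k - 1)) (\<Gamma> i k))"

definition Phi_graph ::
  "diagram \<Rightarrow> diagram \<Rightarrow> nat \<Rightarrow> nat \<Rightarrow>
   (cell \<Rightarrow> nat) \<times> (cell \<Rightarrow> nat) \<times> (nat \<Rightarrow> nat \<Rightarrow> int) \<Rightarrow> (cell \<Rightarrow> nat) \<times> (cell \<Rightarrow> nat) \<Rightarrow> bool" where
  "Phi_graph \<alpha> \<beta> n m = (\<lambda>(U, V, M) (P, Q). \<exists>\<mu> \<Gamma>.
     U \<in> SDT \<beta> \<mu> \<and> V \<in> SDT \<alpha> \<mu> \<and> growth_array n m \<alpha> \<beta> \<mu> U V M \<Gamma> \<and>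
     P \<in> SDT (\<Gamma> n m) \<alpha> \<and> (\<forall>k \<in> {1..m}. domino_of P k = \<Gamma> n k - \<Gamma> n (k - 1)) \<and>
     Q \<in> SDT (\<Gamma> n m) \<beta> \<and> (\<forall>i \<in> {1..n}. domino_of Q i = \<Gamma> i m - \<Gamma> (i - 1) m))"

definition Phi ::
  "diagram \<Rightarrow> diagram \<Rightarrow> nat \<Rightarrow> nat \<Rightarrow>
   (cell \<Rightarrow> nat) \<times> (cell \<Rightarrow> nat) \<times> (nat \<Rightarrow> nat \<Rightarrow> int) \<Rightarrow> (cell \<Rightarrow> nat) \<times> (cell \<Rightarrow> nat)" where
  "Phi \<alpha> \<beta> n m x = (THE y. Phi_graph \<alpha> \<beta> n m x y)"

text \<open>The truncated subtractions are harmless: \<open>PPM n m j\<close> is empty unless \<open>j \<le> n\<close> and \<open>j \<le> m\<close>.\<close>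

definition Phi_dom ::
  "diagram \<Rightarrow> diagram \<Rightarrow> nat \<Rightarrow> nat \<Rightarrow>
   ((cell \<Rightarrow> nat) \<times> (cell \<Rightarrow> nat) \<times> (nat \<Rightarrow> nat \<Rightarrow> int)) set" where
  "Phi_dom \<alpha> \<beta> n m =
     (\<Union>j. \<Union>\<mu> \<in> {\<mu>. skew_of_size \<beta> \<mu> (2 * (m - j)) \<and> skew_of_size \<alpha> \<mu> (2 * (n - j))}.
        SDT \<beta> \<mu> \<times> SDT \<alpha> \<mu> \<times> PPM n m j)"

definition Phi_cod ::
  "diagram \<Rightarrow> diagram \<Rightarrow> nat \<Rightarrow> nat \<Rightarrow> ((cell \<Rightarrow> nat) \<times> (cell \<Rightarrow> nat)) set" where
  "Phi_cod \<alpha> \<beta> n m =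
     (\<Union>l \<in> {l. skew_of_size l \<alpha> (2 * m) \<and> skew_of_size l \<beta> (2 * n)}. SDT l \<alpha> \<times> SDT l \<beta>)"

end

theory Submission
  imports Defs
begin

text \<open>The local rules are invertible. If \<open>\<nu> \<le>\<^sub>d \<kappa>\<close> and \<open>\<nu> \<le>\<^sub>d \<rho>\<close>, with \<open>\<nu> = \<kappa> = \<rho>\<close> in case the matrix entry \<open>x\<close> is
  nonzero, then exactly one \<open>\<tau>\<close> is produced, and \<open>\<kappa> \<le>\<^sub>d \<tau>\<close> and \<open>\<rho> \<le>\<^sub>d \<tau>\<close>. Conversely, if \<open>\<kappa> \<le>\<^sub>d \<tau>\<close> and
  \<open>\<rho> \<le>\<^sub>d \<tau>\<close>, then exactly one pair \<open>(x, \<nu>)\<close> produces \<open>\<tau>\<close>. Moreover \<open>\<rho> = \<tau>\<close> holds iff \<open>\<nu> = \<kappa>\<close> and \<open>x = 0\<close>, and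
  symmetrically for \<open>\<kappa>\<close>. Hence in a growth array the step \<open>\<Gamma> i (k - 1) \<le>\<^sub>d \<Gamma> i k\<close> is trivial exactly as long as
  column \<open>k\<close> of \<open>M\<close> still has a nonzero entry below row \<open>i\<close>: the partial permutation matrix and the trivial
  steps on the top and left borders determine each other, and all steps on the bottom and right borders
  are dominoes. The array can therefore be filled in uniquely from the top left or from the bottom right,
  while chains of dominoes are the same thing as standard domino tableaux.\<close>

section \<open>Adding and removing cells of a partition\<close>

text \<open>The backward step is unique because of how the rules share out the dominoes when
  \<kappa> = \<rho>: (3d) and (3e) produce exactly the horizontal dominoes in rows from 2 on and the
  vertical ones in columns from 2 on, and the two signs of a nonzero entry supply the missing row 1
  and column 1. When \<kappa> \<noteq> \<rho>, the two dominoes are disjoint or share one cell, a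
  corner of a 2 x 2 block whose opposite corner is the cell to be added or removed.

  The obstacle is that the rules are partial: a nonzero entry demands \<nu> = \<kappa> = \<rho>, a
  condition on the array and not on the matrix. Going forward, it is therefore proved together with
  the filling, by an invariant on the trivial steps. Going backward, every square yields an entry
  unconditionally, and it is shown only afterwards, from the strictness of the bottom and right
  borders, that these entries form a partial permutation matrix.\<close>

lemma partition_finite: "is_partition l \<Longrightarrow> finite l"
  by (simp add: is_partition_def)

lemma partition_pos: "is_partition l \<Longrightarrow> (i, j) \<in> l \<Longrightarrow> 1 \<le> i \<and> 1 \<le> j"
  by (auto simp: is_partition_def)

lemma partition_down:
  "is_partition l \<Longrightarrow> (i, j) \<in> l \<Longrightarrow> 1 \<le> i' \<Longrightarrow> i' \<le> i \<Longrightarrow> 1 \<le> j' \<Longrightarrow> j' \<le> j \<Longrightarrow> (i', j') \<in> l"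
  by (fastforce simp: is_partition_def)

lemma partitionI:
  assumes "finite l" "\<And>i j. (i, j) \<in> l \<Longrightarrow> 1 \<le> i \<and> 1 \<le> j"
    "\<And>i j i' j'. (i, j) \<in> l \<Longrightarrow> 1 \<le> i' \<Longrightarrow> i' \<le> i \<Longrightarrow> 1 \<le> j' \<Longrightarrow> j' \<le> j \<Longrightarrow> (i', j') \<in> l"
  shows "is_partition l"
  unfolding is_partition_def using assms by blast

lemma partition_Un: "is_partition k \<Longrightarrow> is_partition l \<Longrightarrow> is_partition (k \<union> l)"
  by (rule partitionI)
    (auto simp: partition_finite dest: partition_pos intro: partition_down)

lemma partition_Int: "is_partition k \<Longrightarrow> is_partition l \<Longrightarrow> is_partition (k \<inter> l)"
  by (rule partitionI)
    (auto simp: partition_finite dest: partition_pos intro: partition_down)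

lemma partition_insert:
  assumes l: "is_partition l" and "1 \<le> p" "1 \<le> q"
    and up: "p = 1 \<or> (p - 1, q) \<in> l" and left: "q = 1 \<or> (p, q - 1) \<in> l"
  shows "is_partition (insert (p, q) l)"
proof (rule partitionI)
  fix i j i' j'
  assume ij: "(i, j) \<in> insert (p, q) l" "1 \<le> i'" "i' \<le> i" "1 \<le> j'" "j' \<le> j"
  show "(i', j') \<in> insert (p, q) l"
  proof (cases "(i, j) \<in> l")
    case True
    then show ?thesis using partition_down[OF l] ij by blast
  next
    case False
    then have e: "i = p" "j = q" using ij by auto
    \<comment> \<open>A cell weakly before \<open>(p, q)\<close> and different from it is weakly
      before \<open>(p - 1, q)\<close> or \<open>(p, q - 1)\<close>.\<close>
    have "i' = p \<and> j' = q \<or> i' \<le> p - 1 \<and> 1 < p \<or> j' \<le> q - 1 \<and> 1 < q" using ij e by auto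
    then consider "i' = p" "j' = q" | "i' \<le> p - 1" "1 < p" | "j' \<le> q - 1" "1 < q" by blast
    then show ?thesis
    proof cases
      case 2
      then show ?thesis using up partition_down[OF l, of "p - 1" q i' j'] ij e by auto
    next
      case 3
      then show ?thesis using left partition_down[OF l, of p "q - 1" i' j'] ij e by auto
    qed auto
  qed
qed (use assms partition_pos[OF l] in \<open>auto simp: partition_finite\<close>)

lemma partition_remove:
  assumes l: "is_partition l" and "(p + 1, q) \<notin> l" "(p, q + 1) \<notin> l"
  shows "is_partition (l - {(p, q)})"
proof (rule partitionI)
  fix i j i' j'
  assume ij: "(i, j) \<in> l - {(p, q)}" "1 \<le> i'" "i' \<le> i" "1 \<le> j'" "j' \<le> j"
  have "(i', j') \<in> l" using partition_down[OF l] ij by blast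
  moreover have "(i', j') \<noteq> (p, q)"
  proof
    assume e: "(i', j') = (p, q)"
    then consider "p + 1 \<le> i" | "q + 1 \<le> j" using ij by fastforce
    then show False
      using partition_down[OF l, of i j "p + 1" q] partition_down[OF l, of i j p "q + 1"] ij e assms
      by cases auto
  qed
  ultimately show "(i', j') \<in> l - {(p, q)}" by blast
qed (use assms partition_pos[OF l] in \<open>auto simp: partition_finite\<close>)

text \<open>Rows are initial segments of the positive integers. This gives the \<open>card\<close>
  in \<open>add_horizontal\<close> its meaning as the last occupied column.\<close>

lemma row_of_partition:
  assumes "is_partition l" "1 \<le> r"
  shows "(r, j) \<in> l \<longleftrightarrow> 1 \<le> j \<and> j \<le> card {j. (r, j) \<in> l}"
proof -
  let ?S = "{j. (r, j) \<in> l}"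
  have fin: "finite ?S"
    by (rule finite_subset[of _ "snd ` l"]) (use assms partition_finite in \<open>force+\<close>)
  have down: "{1..x} \<subseteq> ?S" if "x \<in> ?S" for x
    using partition_down[OF assms(1), of r x] that assms(2) by auto
  have "?S = {1..card ?S}"
  proof (cases "?S = {}")
    case False
    then have "?S = {1..Max ?S}"
      using Max_in[OF fin False] down[of "Max ?S"] Max_ge[OF fin] partition_pos[OF assms(1)] by fastforce
    then show ?thesis by (metis card_atLeastAtMost diff_Suc_1)
  next
    case True
    then show ?thesis by (simp only: True) simp
  qed
  then show ?thesis by (metis atLeastAtMost_iff mem_Collect_eq)
qed

text \<open>Transposition, which carries the description of rows over to columns.\<close>

definition conjugate :: "diagram \<Rightarrow> diagram" where
  "conjugate l = prod.swap ` l"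

lemma mem_conjugate [simp]: "(i, j) \<in> conjugate l \<longleftrightarrow> (j, i) \<in> l"
  by (force simp: conjugate_def)

lemma partition_conjugate: "is_partition l \<Longrightarrow> is_partition (conjugate l)"
  by (rule partitionI)
    (auto simp: conjugate_def partition_finite dest: partition_pos intro: partition_down)

lemma column_of_partition:
  assumes "is_partition l" "1 \<le> c"
  shows "(i, c) \<in> l \<longleftrightarrow> 1 \<le> i \<and> i \<le> card {i. (i, c) \<in> l}"
  using row_of_partition[OF partition_conjugate[OF assms(1)] assms(2), of i] by simp

text \<open>Trades the row length for its first free column \<open>q\<close>, the form in which
  neighbours of the new cells can be discussed.\<close>

lemma add_horizontal_eq:
  assumes "is_partition l" "1 \<le> r" "(r, q) \<notin> l" "1 \<le> q" "q = 1 \<or> (r, q - 1) \<in> l"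
  shows "add_horizontal l r = l \<union> {(r, q), (r, q + 1)}"
proof -
  have "card {j. (r, j) \<in> l} + 1 = q"
    using assms(3-5) row_of_partition[OF assms(1,2), of q] row_of_partition[OF assms(1,2), of "q - 1"]
    by linarith
  then show ?thesis by (auto simp: add_horizontal_def Let_def)
qed

lemma add_vertical_eq:
  assumes "is_partition l" "1 \<le> c" "(p, c) \<notin> l" "1 \<le> p" "p = 1 \<or> (p - 1, c) \<in> l"
  shows "add_vertical l c = l \<union> {(p, c), (p + 1, c)}"
proof -
  have "card {i. (i, c) \<in> l} + 1 = p"
    using assms(3-5) column_of_partition[OF assms(1,2), of p] column_of_partition[OF assms(1,2), of "p - 1"]
    by linarith
  then show ?thesis by (auto simp: add_vertical_def Let_def)
qed

lemma ex_row_end: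
  assumes "is_partition l" "1 \<le> r"
  obtains q where "1 \<le> q" "(r, q) \<notin> l" "q = 1 \<or> (r, q - 1) \<in> l"
proof -
  define a where "a = card {j. (r, j) \<in> l}"
  have "(r, j) \<in> l \<longleftrightarrow> 1 \<le> j \<and> j \<le> a" for j
    unfolding a_def by (rule row_of_partition[OF assms])
  then show thesis using that[of "a + 1"] by (cases "a = 0") auto
qed

lemma ex_column_end:
  assumes "is_partition l" "1 \<le> c"
  obtains p where "1 \<le> p" "(p, c) \<notin> l" "p = 1 \<or> (p - 1, c) \<in> l"
proof -
  define a where "a = card {i. (i, c) \<in> l}"
  have "(i, c) \<in> l \<longleftrightarrow> 1 \<le> i \<and> i \<le> a" for i
    unfolding a_def by (rule column_of_partition[OF assms])
  then show thesis using that[of "a + 1"] by (cases "a = 0") auto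
qed

section \<open>Domino steps in coordinates\<close>

lemma less_d_partition: "k <\<^sub>d l \<Longrightarrow> is_partition k \<and> is_partition l"
  by (simp add: less_d_def)

text \<open>Besides the position of the domino, each case records the neighbours to its left and
  above. They lie in \<open>k\<close> because \<open>l\<close> is closed downwards, and they later
  decide where two dominoes can meet.\<close>

lemma less_d_cases:
  assumes "k <\<^sub>d l"
  obtains (horizontal) p q where "1 \<le> p" "1 \<le> q" "l - k = {(p, q), (p, q + 1)}"
      "l = k \<union> {(p, q), (p, q + 1)}" "(p, q) \<notin> k" "(p, q + 1) \<notin> k"
      "q = 1 \<or> (p, q - 1) \<in> k" "p = 1 \<or> (p - 1, q) \<in> k \<and> (p - 1, q + 1) \<in> k"
  | (vertical) p q where "1 \<le> p" "1 \<le> q" "l - k = {(p, q), (p + 1, q)}"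
      "l = k \<union> {(p, q), (p + 1, q)}" "(p, q) \<notin> k" "(p + 1, q) \<notin> k"
      "p = 1 \<or> (p - 1, q) \<in> k" "q = 1 \<or> (p, q - 1) \<in> k \<and> (p + 1, q - 1) \<in> k"
proof -
  have l: "is_partition l" and k: "is_partition k" and sub: "k \<subset> l" and dom: "is_domino (l - k)"
    using assms by (auto simp: less_d_def)
  from dom consider p q where "l - k = {(p, q), (p, q + 1)}" | p q where "l - k = {(p, q), (p + 1, q)}"
    by (auto simp: is_domino_def horizontal_domino_def vertical_domino_def)
  then show thesis
  proof cases
    case 1
    then have mem: "(p, q) \<in> l" "(p, q + 1) \<in> l" by blast+
    have pos: "1 \<le> p" "1 \<le> q" using partition_pos[OF l mem(1)] by auto
    have eq: "l = k \<union> {(p, q), (p, q + 1)}" using 1 sub by blast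
    have notin: "(p, q) \<notin> k" "(p, q + 1) \<notin> k" using 1 by blast+
    have "(p, q - 1) \<in> l" if "q \<noteq> 1"
      using partition_down[OF l mem(1), of p "q - 1"] pos that by simp
    then have left: "q = 1 \<or> (p, q - 1) \<in> k" using pos unfolding eq by (cases q) auto
    have "(p - 1, q) \<in> l" "(p - 1, q + 1) \<in> l" if "p \<noteq> 1"
      using partition_down[OF l mem(1), of "p - 1" q] partition_down[OF l mem(2), of "p - 1" "q + 1"] pos that
      by simp_all
    then have up: "p = 1 \<or> (p - 1, q) \<in> k \<and> (p - 1, q + 1) \<in> k"
      using pos unfolding eq by (cases p) auto
    show thesis by (rule that(1)[OF pos 1 eq notin left up])
  next
    case 2
    then have mem: "(p, q) \<in> l" "(p + 1, q) \<in> l" by blast+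
    have pos: "1 \<le> p" "1 \<le> q" using partition_pos[OF l mem(1)] by auto
    have eq: "l = k \<union> {(p, q), (p + 1, q)}" using 2 sub by blast
    have notin: "(p, q) \<notin> k" "(p + 1, q) \<notin> k" using 2 by blast+
    have "(p - 1, q) \<in> l" if "p \<noteq> 1"
      using partition_down[OF l mem(1), of "p - 1" q] pos that by simp
    then have up: "p = 1 \<or> (p - 1, q) \<in> k" using pos unfolding eq by (cases p) auto
    have "(p, q - 1) \<in> l" "(p + 1, q - 1) \<in> l" if "q \<noteq> 1"
      using partition_down[OF l mem(1), of p "q - 1"] partition_down[OF l mem(2), of "p + 1" "q - 1"] pos that
      by simp_all
    then have left: "q = 1 \<or> (p, q - 1) \<in> k \<and> (p + 1, q - 1) \<in> k"
      using pos unfolding eq by (cases q) auto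
    show thesis by (rule that(2)[OF pos 2 eq notin up left])
  qed
qed

text \<open>The cell above the left half follows from the one above the right half by closure.
  Inserting the left half first makes it the left neighbour of the right half.\<close>

lemma less_d_horizontalI:
  assumes "is_partition k" "1 \<le> p" "1 \<le> q" "(p, q) \<notin> k" "q = 1 \<or> (p, q - 1) \<in> k"
    "p = 1 \<or> (p - 1, q + 1) \<in> k"
  shows "k <\<^sub>d k \<union> {(p, q), (p, q + 1)}"
proof -
  have notin: "(p, q + 1) \<notin> k" using partition_down[OF assms(1), of p "q + 1" p q] assms by auto
  have "p = 1 \<or> (p - 1, q) \<in> k"
    using assms partition_down[OF assms(1), of "p - 1" "q + 1" "p - 1" q] by (cases "p = 1") auto
  with assms(5) have "is_partition (insert (p, q) k)" using assms(1-4) by (intro partition_insert)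
  then have "is_partition (insert (p, q + 1) (insert (p, q) k))"
    using assms(2,3,6) by (simp add: partition_insert)
  then have part: "is_partition (k \<union> {(p, q), (p, q + 1)})" by (simp add: insert_commute)
  have diff: "k \<union> {(p, q), (p, q + 1)} - k = {(p, q), (p, q + 1)}" using assms(4) notin by blast
  show ?thesis
    unfolding less_d_def diff is_domino_def horizontal_domino_def using assms(1,4) part by blast
qed

lemma less_d_verticalI:
  assumes "is_partition k" "1 \<le> p" "1 \<le> q" "(p, q) \<notin> k" "p = 1 \<or> (p - 1, q) \<in> k"
    "q = 1 \<or> (p + 1, q - 1) \<in> k"
  shows "k <\<^sub>d k \<union> {(p, q), (p + 1, q)}"
proof -
  have notin: "(p + 1, q) \<notin> k" using partition_down[OF assms(1), of "p + 1" q p q] assms by auto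
  have "q = 1 \<or> (p, q - 1) \<in> k"
    using assms partition_down[OF assms(1), of "p + 1" "q - 1" p "q - 1"] by (cases "q = 1") auto
  with assms(5) have "is_partition (insert (p, q) k)" using assms(1-4) by (intro partition_insert)
  then have "is_partition (insert (p + 1, q) (insert (p, q) k))"
    using assms(2,3,6) by (simp add: partition_insert)
  then have part: "is_partition (k \<union> {(p, q), (p + 1, q)})" by (simp add: insert_commute)
  have diff: "k \<union> {(p, q), (p + 1, q)} - k = {(p, q), (p + 1, q)}" using assms(4) notin by blast
  show ?thesis
    unfolding less_d_def diff is_domino_def vertical_domino_def using assms(1,4) part by blast
qed

section \<open>Domino steps\<close>

lemma less_d_irrefl [simp]: "\<not> k <\<^sub>d k"
  by (simp add: less_d_def)

lemma less_d_subset: "k <\<^sub>d l \<Longrightarrow> k \<subseteq> l"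
  by (auto simp: less_d_def)

lemma le_d_subset: "k \<le>\<^sub>d l \<Longrightarrow> k \<subseteq> l"
  by (auto simp: le_d_def less_d_def)

lemma not_horizontal_and_vertical: "horizontal_domino r D \<Longrightarrow> vertical_domino c D \<Longrightarrow> False"
  by (auto simp: horizontal_domino_def vertical_domino_def doubleton_eq_iff)

lemma horizontal_domino_row_unique: "horizontal_domino r D \<Longrightarrow> horizontal_domino r' D \<Longrightarrow> r = r'"
  by (auto simp: horizontal_domino_def doubleton_eq_iff)

lemma vertical_domino_column_unique: "vertical_domino c D \<Longrightarrow> vertical_domino c' D \<Longrightarrow> c = c'"
  by (auto simp: vertical_domino_def doubleton_eq_iff)

text \<open>Used to show that nothing of \<open>l\<close> lies beyond a removable domino, which pins
  such a domino to the end of its row or column.\<close>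

lemma skew_upward_closed:
  assumes "is_partition k" "is_partition l" "(i, j) \<in> l - k" "(i', j') \<in> l" "i \<le> i'" "j \<le> j'"
  shows "(i', j') \<in> l - k"
  using assms partition_pos[OF assms(2), of i j] partition_down[OF assms(1), of i' j' i j] by auto

text \<open>A removable horizontal domino consists of the last two cells of its row. Of two
  candidates, the end cell of the one further right would have to lie in both.\<close>

lemma horizontal_predecessor_unique:
  assumes "k <\<^sub>d l" "k' <\<^sub>d l" "horizontal_domino r (l - k)" "horizontal_domino r (l - k')"
  shows "k = k'"
proof -
  obtain q q' where q: "l - k = {(r, q), (r, q + 1)}" and q': "l - k' = {(r, q'), (r, q' + 1)}"
    using assms(3,4) by (auto simp: horizontal_domino_def)
  have p: "is_partition k" "is_partition k'" "is_partition l" using assms less_d_partition by auto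
  have "(r, max q q' + 1) \<in> l - k"
    by (rule skew_upward_closed[OF p(1,3), of r "q + 1"]) (use q q' in \<open>auto simp: max_def\<close>)
  moreover have "(r, max q q' + 1) \<in> l - k'"
    by (rule skew_upward_closed[OF p(2,3), of r "q' + 1"]) (use q q' in \<open>auto simp: max_def\<close>)
  ultimately have "q = q'" unfolding q q' by (auto simp: max_def split: if_splits)
  then have "l - k = l - k'" using q q' by simp
  then show ?thesis using assms(1,2) less_d_subset by blast
qed

lemma vertical_predecessor_unique:
  assumes "k <\<^sub>d l" "k' <\<^sub>d l" "vertical_domino c (l - k)" "vertical_domino c (l - k')"
  shows "k = k'"
proof -
  obtain q q' where q: "l - k = {(q, c), (q + 1, c)}" and q': "l - k' = {(q', c), (q' + 1, c)}"
    using assms(3,4) by (auto simp: vertical_domino_def)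
  have p: "is_partition k" "is_partition k'" "is_partition l" using assms less_d_partition by auto
  have "(max q q' + 1, c) \<in> l - k"
    by (rule skew_upward_closed[OF p(1,3), of "q + 1" c]) (use q q' in \<open>auto simp: max_def\<close>)
  moreover have "(max q q' + 1, c) \<in> l - k'"
    by (rule skew_upward_closed[OF p(2,3), of "q' + 1" c]) (use q q' in \<open>auto simp: max_def\<close>)
  ultimately have "q = q'" unfolding q q' by (auto simp: max_def split: if_splits)
  then have "l - k = l - k'" using q q' by simp
  then show ?thesis using assms(1,2) less_d_subset by blast
qed

section \<open>Dominoes added by rules (1), (2), (3d), (3e), and their removal\<close>

lemma add_horizontal_first_row:
  assumes "is_partition k"
  shows "k <\<^sub>d add_horizontal k 1 \<and> horizontal_domino 1 (add_horizontal k 1 - k)"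
proof -
  obtain q where q: "1 \<le> q" "(1, q) \<notin> k" "q = 1 \<or> (1, q - 1) \<in> k"
    using ex_row_end[OF assms, of 1] by auto
  then have "(1, q + 1) \<notin> k" using partition_down[OF assms, of 1 "q + 1" 1 q] by auto
  then have "k \<union> {(1, q), (1, q + 1)} - k = {(1, q), (1, q + 1)}" using q by blast
  moreover have "add_horizontal k 1 = k \<union> {(1, q), (1, q + 1)}"
    by (rule add_horizontal_eq[OF assms _ q(2,1,3)]) simp
  moreover have "k <\<^sub>d k \<union> {(1, q), (1, q + 1)}"
    by (rule less_d_horizontalI[OF assms _ q(1,2,3)]) simp_all
  ultimately show ?thesis by (metis horizontal_domino_def)
qed

lemma add_vertical_first_column:
  assumes "is_partition k"
  shows "k <\<^sub>d add_vertical k 1 \<and> vertical_domino 1 (add_vertical k 1 - k)"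
proof -
  obtain q where q: "1 \<le> q" "(q, 1) \<notin> k" "q = 1 \<or> (q - 1, 1) \<in> k"
    using ex_column_end[OF assms, of 1] by auto
  then have "(q + 1, 1) \<notin> k" using partition_down[OF assms, of "q + 1" 1 q 1] by auto
  then have "k \<union> {(q, 1), (q + 1, 1)} - k = {(q, 1), (q + 1, 1)}" using q by blast
  moreover have "add_vertical k 1 = k \<union> {(q, 1), (q + 1, 1)}"
    by (rule add_vertical_eq[OF assms _ q(2,1,3)]) simp
  moreover have "k <\<^sub>d k \<union> {(q, 1), (q + 1, 1)}"
    by (rule less_d_verticalI[OF assms q(1) _ q(2,3)]) simp_all
  ultimately show ?thesis by (metis vertical_domino_def)
qed

text \<open>No cell of \<open>l\<close> lies below the domino at columns \<open>p\<close>,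
  \<open>p + 1\<close> of row \<open>r\<close>, so row \<open>r + 1\<close> stops before column
  \<open>p\<close>. Its next two cells are therefore covered by row \<open>r\<close>.\<close>

lemma add_horizontal_next_row:
  assumes "k <\<^sub>d l" "horizontal_domino r (l - k)"
  shows "l <\<^sub>d add_horizontal l (r + 1) \<and> horizontal_domino (r + 1) (add_horizontal l (r + 1) - l)"
proof -
  have k: "is_partition k" and l: "is_partition l" using assms less_d_partition by auto
  obtain p where p: "l - k = {(r, p), (r, p + 1)}" using assms by (auto simp: horizontal_domino_def)
  have mem: "(r, p) \<in> l" "(r, p + 1) \<in> l" "(r, p) \<notin> k" using p by blast+
  have pos: "1 \<le> r" "1 \<le> p" using partition_pos[OF l mem(1)] by auto
  obtain q where q: "1 \<le> q" "(r + 1, q) \<notin> l" "q = 1 \<or> (r + 1, q - 1) \<in> l"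
    using ex_row_end[OF l, of "r + 1"] by auto
  have "(r + 1, p) \<notin> l" using skew_upward_closed[OF k l, of r p "r + 1" p] p by auto
  then have "q \<le> p" using q partition_down[OF l, of "r + 1" "q - 1" "r + 1" p] pos by fastforce
  then have above: "(r, q + 1) \<in> l" using partition_down[OF l mem(2), of r "q + 1"] pos by simp
  have "(r + 1, q + 1) \<notin> l" using partition_down[OF l, of "r + 1" "q + 1" "r + 1" q] q by auto
  then have "l \<union> {(r + 1, q), (r + 1, q + 1)} - l = {(r + 1, q), (r + 1, q + 1)}" using q by blast
  moreover have "add_horizontal l (r + 1) = l \<union> {(r + 1, q), (r + 1, q + 1)}"
    by (rule add_horizontal_eq[OF l _ q(2,1,3)]) simp
  moreover have "l <\<^sub>d l \<union> {(r + 1, q), (r + 1, q + 1)}"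
    by (rule less_d_horizontalI[OF l _ q(1,2,3)]) (use above in simp_all)
  ultimately show ?thesis by (metis horizontal_domino_def)
qed

lemma add_vertical_next_column:
  assumes "k <\<^sub>d l" "vertical_domino c (l - k)"
  shows "l <\<^sub>d add_vertical l (c + 1) \<and> vertical_domino (c + 1) (add_vertical l (c + 1) - l)"
proof -
  have k: "is_partition k" and l: "is_partition l" using assms less_d_partition by auto
  obtain p where p: "l - k = {(p, c), (p + 1, c)}" using assms by (auto simp: vertical_domino_def)
  have mem: "(p, c) \<in> l" "(p + 1, c) \<in> l" "(p, c) \<notin> k" using p by blast+
  have pos: "1 \<le> p" "1 \<le> c" using partition_pos[OF l mem(1)] by auto
  obtain q where q: "1 \<le> q" "(q, c + 1) \<notin> l" "q = 1 \<or> (q - 1, c + 1) \<in> l"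
    using ex_column_end[OF l, of "c + 1"] by auto
  have "(p, c + 1) \<notin> l" using skew_upward_closed[OF k l, of p c p "c + 1"] p by auto
  then have "q \<le> p" using q partition_down[OF l, of "q - 1" "c + 1" p "c + 1"] pos by fastforce
  then have above: "(q + 1, c) \<in> l" using partition_down[OF l mem(2), of "q + 1" c] pos by simp
  have "(q + 1, c + 1) \<notin> l" using partition_down[OF l, of "q + 1" "c + 1" q "c + 1"] q by auto
  then have "l \<union> {(q, c + 1), (q + 1, c + 1)} - l = {(q, c + 1), (q + 1, c + 1)}" using q by blast
  moreover have "add_vertical l (c + 1) = l \<union> {(q, c + 1), (q + 1, c + 1)}"
    by (rule add_vertical_eq[OF l _ q(2,1,3)]) simp
  moreover have "l <\<^sub>d l \<union> {(q, c + 1), (q + 1, c + 1)}"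
    by (rule less_d_verticalI[OF l q(1) _ q(2,3)]) (use above in simp_all)
  ultimately show ?thesis by (metis vertical_domino_def)
qed

text \<open>Inverts \<open>add_horizontal_next_row\<close>. Row \<open>r + 1\<close> of
  \<open>k\<close> ends just before column \<open>p\<close>, whereas row \<open>r\<close> reaches at
  least column \<open>p + 1\<close>, so the last two cells of row \<open>r\<close> have nothing
  below them and can be removed.\<close>

lemma horizontal_predecessor:
  assumes "k <\<^sub>d l" "horizontal_domino (r + 1) (l - k)" "1 \<le> r"
  obtains h where "h <\<^sub>d k" "horizontal_domino r (k - h)" "l = add_horizontal k (r + 1)"
proof -
  have k: "is_partition k" and l: "is_partition l" using assms less_d_partition by auto
  obtain p where p: "l - k = {(r + 1, p), (r + 1, p + 1)}" using assms by (auto simp: horizontal_domino_def)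
  have mem: "(r + 1, p) \<in> l" "(r + 1, p + 1) \<in> l" "(r + 1, p) \<notin> k" using p by blast+
  have pos: "1 \<le> p" using partition_pos[OF l mem(1)] by auto
  have eq: "l = k \<union> {(r + 1, p), (r + 1, p + 1)}" using p less_d_subset[OF assms(1)] by blast
  have "(r, p + 1) \<in> l" using partition_down[OF l mem(2), of r "p + 1"] assms(3) by simp
  then have above: "(r, p + 1) \<in> k" using eq by auto
  have "(r + 1, p - 1) \<in> l" if "p \<noteq> 1"
    using partition_down[OF l mem(1), of "r + 1" "p - 1"] pos that by simp
  then have left: "p = 1 \<or> (r + 1, p - 1) \<in> k" using pos unfolding eq by (cases p) auto
  have add: "l = add_horizontal k (r + 1)"
    using add_horizontal_eq[OF k _ mem(3) pos left] eq by simp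
  obtain e where e: "1 \<le> e" "(r, e) \<notin> k" "e = 1 \<or> (r, e - 1) \<in> k"
    using ex_row_end[OF k assms(3)] by auto
  have "p + 1 < e"
    using e above partition_down[OF k above, of r e] assms(3) by (meson le_refl not_le)
  \<comment> \<open>As \<open>e\<close> is the first free column of row \<open>r\<close>, its last
    two cells are in columns \<open>q\<close> and \<open>q + 1\<close>.\<close>
  then obtain q where q: "e = q + 2" "p \<le> q" by (metis add_2_eq_Suc' less_iff_Suc_add Suc_eq_plus1 add_Suc le_add1)
  have cells: "(r, q + 1) \<in> k" "(r, q) \<in> k"
    using e q pos partition_down[OF k, of r "q + 1" r q] assms(3) by auto
  have below: "(r + 1, q) \<notin> k" "(r + 1, q + 1) \<notin> k"
    using mem(3) partition_down[OF k, of "r + 1" q "r + 1" p]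
      partition_down[OF k, of "r + 1" "q + 1" "r + 1" p] q pos by auto
  \<comment> \<open>The right cell goes first, so that each removal takes away a corner.\<close>
  define h where "h = k - {(r, q + 1)} - {(r, q)}"
  have "is_partition (k - {(r, q + 1)})"
    by (rule partition_remove[OF k]) (use below e q in auto)
  then have "is_partition h"
    unfolding h_def by (rule partition_remove) (use below in auto)
  moreover have diff: "k - h = {(r, q), (r, q + 1)}" using cells by (auto simp: h_def)
  moreover have "h \<subset> k" using cells by (auto simp: h_def)
  ultimately have "h <\<^sub>d k" "horizontal_domino r (k - h)"
    using k by (auto simp: less_d_def is_domino_def horizontal_domino_def)
  then show thesis using that add by blast
qed

lemma vertical_predecessor:
  assumes "k <\<^sub>d l" "vertical_domino (c + 1) (l - k)" "1 \<le> c"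
  obtains h where "h <\<^sub>d k" "vertical_domino c (k - h)" "l = add_vertical k (c + 1)"
proof -
  have k: "is_partition k" and l: "is_partition l" using assms less_d_partition by auto
  obtain p where p: "l - k = {(p, c + 1), (p + 1, c + 1)}" using assms by (auto simp: vertical_domino_def)
  have mem: "(p, c + 1) \<in> l" "(p + 1, c + 1) \<in> l" "(p, c + 1) \<notin> k" using p by blast+
  have pos: "1 \<le> p" using partition_pos[OF l mem(1)] by auto
  have eq: "l = k \<union> {(p, c + 1), (p + 1, c + 1)}" using p less_d_subset[OF assms(1)] by blast
  have "(p + 1, c) \<in> l" using partition_down[OF l mem(2), of "p + 1" c] assms(3) by simp
  then have left: "(p + 1, c) \<in> k" using eq by auto
  have "(p - 1, c + 1) \<in> l" if "p \<noteq> 1"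
    using partition_down[OF l mem(1), of "p - 1" "c + 1"] pos that by simp
  then have above: "p = 1 \<or> (p - 1, c + 1) \<in> k" using pos unfolding eq by (cases p) auto
  have add: "l = add_vertical k (c + 1)"
    using add_vertical_eq[OF k _ mem(3) pos above] eq by simp
  obtain e where e: "1 \<le> e" "(e, c) \<notin> k" "e = 1 \<or> (e - 1, c) \<in> k"
    using ex_column_end[OF k assms(3)] by auto
  have "p + 1 < e"
    using e left partition_down[OF k left, of e c] assms(3) by (meson le_refl not_le)
  then obtain q where q: "e = q + 2" "p \<le> q" by (metis add_2_eq_Suc' less_iff_Suc_add Suc_eq_plus1 add_Suc le_add1)
  have cells: "(q + 1, c) \<in> k" "(q, c) \<in> k"
    using e q pos partition_down[OF k, of "q + 1" c q c] assms(3) by auto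
  have right: "(q, c + 1) \<notin> k" "(q + 1, c + 1) \<notin> k"
    using mem(3) partition_down[OF k, of q "c + 1" p "c + 1"]
      partition_down[OF k, of "q + 1" "c + 1" p "c + 1"] q pos by auto
  define h where "h = k - {(q + 1, c)} - {(q, c)}"
  have "is_partition (k - {(q + 1, c)})"
    by (rule partition_remove[OF k]) (use right e q in auto)
  then have "is_partition h"
    unfolding h_def by (rule partition_remove) (use right in auto)
  moreover have diff: "k - h = {(q, c), (q + 1, c)}" using cells by (auto simp: h_def)
  moreover have "h \<subset> k" using cells by (auto simp: h_def)
  ultimately have "h <\<^sub>d k" "vertical_domino c (k - h)"
    using k by (auto simp: less_d_def is_domino_def vertical_domino_def)
  then show thesis using that add by blast
qed


section \<open>Overlapping dominoes\<close>

text \<open>Dominoes of the same orientation that meet both start at the first free cell of the same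
  row or column and so coincide. A horizontal and a vertical one meet in their first cells: in any
  other position a neighbour that must lie in \<open>k\<close> would be a cell of one of the
  dominoes.\<close>

lemma overlap_above:
  assumes "k <\<^sub>d l" "k <\<^sub>d l'" "l \<noteq> l'" "(l - k) \<inter> (l' - k) \<noteq> {}"
  obtains (hv) p q where "l - k = {(p, q), (p, q + 1)}" "l' - k = {(p, q), (p + 1, q)}"
  | (vh) p q where "l - k = {(p, q), (p + 1, q)}" "l' - k = {(p, q), (p, q + 1)}"
  using assms(1)
proof (cases rule: less_d_cases)
  case (horizontal p q)
  note h = horizontal
  show ?thesis using assms(2)
  proof (cases rule: less_d_cases)
    case (horizontal p' q')
    have "p = p'" using assms(4) unfolding h(3) horizontal(3) by auto
    moreover have "q = q'"
      using assms(4) h(1,2,5-7) horizontal(1,2,5-7) \<open>p = p'\<close> unfolding h(3) horizontal(3) by auto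
    ultimately show ?thesis using h(4) horizontal(4) assms(3) by simp
  next
    case (vertical p' q')
    have "p = p' \<and> q = q'"
      using assms(4) h(1,2,5-) vertical(1,2,5-) unfolding h(3) vertical(3) by auto
    then show ?thesis using hv[of p q] h(3) vertical(3) by simp
  qed
next
  case (vertical p q)
  note v = vertical
  show ?thesis using assms(2)
  proof (cases rule: less_d_cases)
    case (horizontal p' q')
    have "p = p' \<and> q = q'"
      using assms(4) v(1,2,5-) horizontal(1,2,5-) unfolding v(3) horizontal(3) by auto
    then show ?thesis using vh[of p q] v(3) horizontal(3) by simp
  next
    case (vertical p' q')
    have "q = q'" using assms(4) unfolding v(3) vertical(3) by auto
    moreover have "p = p'"
      using assms(4) v(1,2,5-7) vertical(1,2,5-7) \<open>q = q'\<close> unfolding v(3) vertical(3) by auto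
    ultimately show ?thesis using v(4) vertical(4) assms(3) by simp
  qed
qed

text \<open>The overlap bounds the coordinates enough to apply upward closure in both directions:
  the last cell of each domino belongs to the other one, so the last cells agree.\<close>

lemma overlap_below_horizontal_vertical:
  assumes "k <\<^sub>d l" "k' <\<^sub>d l" "(l - k) \<inter> (l - k') \<noteq> {}"
    "l - k = {(i, j), (i, j + 1)}" "l - k' = {(i', j'), (i' + 1, j')}"
  shows "i = i' + 1 \<and> j' = j + 1"
proof -
  have p: "is_partition k" "is_partition k'" "is_partition l" using assms less_d_partition by auto
  have mem: "(i, j + 1) \<in> l" "(i' + 1, j') \<in> l" using assms(4,5) by blast+
  have up: "(i' + 1, j') \<in> l - k" if "i \<le> i' + 1" "j \<le> j'"
    by (rule skew_upward_closed[OF p(1,3) _ mem(2) that]) (use assms(4) in auto)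
  have up': "(i, j + 1) \<in> l - k'" if "i' \<le> i" "j' \<le> j + 1"
    by (rule skew_upward_closed[OF p(2,3) _ mem(1) that]) (use assms(5) in auto)
  show ?thesis using up up' assms(3) unfolding assms(4,5) by auto
qed

text \<open>Equal orientations are excluded by uniqueness of predecessors. The shared cell is
  written \<open>(p + 1, q + 1)\<close> so that \<open>(p, q)\<close> becomes the cell named in rule
  (3c).\<close>

lemma overlap_below:
  assumes "k <\<^sub>d l" "k' <\<^sub>d l" "k \<noteq> k'" "(l - k) \<inter> (l - k') \<noteq> {}"
  obtains (hv) p q where
      "l - k = {(p + 1, q), (p + 1, q + 1)}" "l - k' = {(p, q + 1), (p + 1, q + 1)}"
  | (vh) p q where
      "l - k = {(p, q + 1), (p + 1, q + 1)}" "l - k' = {(p + 1, q), (p + 1, q + 1)}"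
proof -
  consider (h) i j where "l - k = {(i, j), (i, j + 1)}" | (v) i j where "l - k = {(i, j), (i + 1, j)}"
    using assms(1) by (auto simp: less_d_def is_domino_def horizontal_domino_def vertical_domino_def)
  then show thesis
  proof cases
    case h
    consider (h') i' j' where "l - k' = {(i', j'), (i', j' + 1)}"
      | (v') i' j' where "l - k' = {(i', j'), (i' + 1, j')}"
      using assms(2) by (auto simp: less_d_def is_domino_def horizontal_domino_def vertical_domino_def)
    then show thesis
    proof cases
      case h'
      then have "i' = i" using assms(4) h by auto
      then have "k = k'" using assms(1,2) h h'
        by (intro horizontal_predecessor_unique[of k l k' i]) (auto simp: horizontal_domino_def)
      then show thesis using assms(3) by simp
    next
      case v'
      then show thesis using overlap_below_horizontal_vertical[OF assms(1,2,4) h v'] hv[of i' j] h v' by simp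
    qed
  next
    case v
    consider (h') i' j' where "l - k' = {(i', j'), (i', j' + 1)}"
      | (v') i' j' where "l - k' = {(i', j'), (i' + 1, j')}"
      using assms(2) by (auto simp: less_d_def is_domino_def horizontal_domino_def vertical_domino_def)
    then show thesis
    proof cases
      case h'
      have "(l - k') \<inter> (l - k) \<noteq> {}" using assms(4) by blast
      then have "i' = i + 1" "j = j' + 1"
        using overlap_below_horizontal_vertical[OF assms(2,1) _ h' v] by blast+
      then show thesis using vh[of i j'] h' v by blast
    next
      case v'
      then have "j' = j" using assms(4) v by auto
      then have "k = k'" using assms(1,2) v v'
        by (intro vertical_predecessor_unique[of k l k' j]) (auto simp: vertical_domino_def)
      then show thesis using assms(3) by simp
    qed
  qed
qed

section \<open>The local rules\<close>

lemma local_rule_pos: "local_rule 1 \<nu> \<kappa> \<rho> \<tau> \<longleftrightarrow> \<nu> = \<kappa> \<and> \<kappa> = \<rho> \<and> \<tau> = add_horizontal \<kappa> 1"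
  by (auto simp: local_rule.simps)

lemma local_rule_neg: "local_rule (- 1) \<nu> \<kappa> \<rho> \<tau> \<longleftrightarrow> \<nu> = \<kappa> \<and> \<kappa> = \<rho> \<and> \<tau> = add_vertical \<kappa> 1"
  by (auto simp: local_rule.simps)

lemma local_rule_zero_left: "\<nu> \<subseteq> \<rho> \<Longrightarrow> local_rule 0 \<nu> \<nu> \<rho> \<tau> \<longleftrightarrow> \<tau> = \<rho>"
  by (auto simp: local_rule.simps)

lemma local_rule_zero_right: "\<nu> \<subseteq> \<kappa> \<Longrightarrow> local_rule 0 \<nu> \<kappa> \<nu> \<tau> \<longleftrightarrow> \<tau> = \<kappa>"
  by (auto simp: local_rule.simps)

text \<open>What is left of the rules once strict steps have excluded (3a); determinism is then a
  comparison of the four disjuncts.\<close>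

lemma local_rule_zero_proper:
  assumes "\<nu> <\<^sub>d \<kappa>" "\<nu> <\<^sub>d \<rho>"
  shows "local_rule 0 \<nu> \<kappa> \<rho> \<tau> \<longleftrightarrow>
    \<kappa> \<noteq> \<rho> \<and> (\<kappa> - \<nu>) \<inter> (\<rho> - \<nu>) = {} \<and> \<tau> = \<kappa> \<union> \<rho> \<or>
    \<kappa> \<noteq> \<rho> \<and> (\<exists>p q. (\<kappa> - \<nu>) \<inter> (\<rho> - \<nu>) = {(p, q)} \<and> \<tau> = \<kappa> \<union> \<rho> \<union> {(p + 1, q + 1)}) \<or>
    \<kappa> = \<rho> \<and> (\<exists>r. horizontal_domino r (\<kappa> - \<nu>) \<and> \<tau> = add_horizontal \<kappa> (r + 1)) \<or>
    \<kappa> = \<rho> \<and> (\<exists>c. vertical_domino c (\<kappa> - \<nu>) \<and> \<tau> = add_vertical \<kappa> (c + 1))" (is "_ \<longleftrightarrow> ?R")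
proof
  have ne: "\<nu> \<noteq> \<kappa>" "\<nu> \<noteq> \<rho>" using assms by auto
  assume "local_rule 0 \<nu> \<kappa> \<rho> \<tau>"
  then show ?R by cases (use ne in blast)+
next
  assume ?R
  then show "local_rule 0 \<nu> \<kappa> \<rho> \<tau>" using assms local_rule.intros by metis
qed

text \<open>The two dominoes cover three cells of a 2 x 2 block and rule (3c) adds the fourth. Over
  \<kappa> this completes the lower row of the block, over \<rho> its right column, so each
  orientation is swapped from one side of the square to the opposite one.\<close>

lemma local_rule_zero_overlap:
  assumes "\<nu> <\<^sub>d \<kappa>" "\<nu> <\<^sub>d \<rho>" "\<kappa> - \<nu> = {(p, q), (p, q + 1)}" "\<rho> - \<nu> = {(p, q), (p + 1, q)}"
    and \<tau>: "\<tau> = \<kappa> \<union> \<rho> \<union> {(p + 1, q + 1)}"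
  shows "\<kappa> <\<^sub>d \<tau> \<and> \<rho> <\<^sub>d \<tau> \<and> (p + 1, q + 1) \<notin> \<kappa> \<union> \<rho>"
proof -
  have part: "is_partition \<nu>" "is_partition \<kappa>" "is_partition \<rho>" using assms less_d_partition by auto
  have mem: "(p, q) \<in> \<kappa>" "(p, q + 1) \<in> \<kappa>" "(p + 1, q) \<in> \<rho>" using assms(3,4) by blast+
  have pos: "1 \<le> p" "1 \<le> q" using partition_pos[OF part(2) mem(1)] by auto
  have \<kappa>: "\<kappa> = \<nu> \<union> {(p, q), (p, q + 1)}" and \<rho>: "\<rho> = \<nu> \<union> {(p, q), (p + 1, q)}"
    using assms(3,4) less_d_subset assms(1,2) by blast+
  have notin: "(p, q) \<notin> \<nu>" "(p, q + 1) \<notin> \<nu>" "(p + 1, q) \<notin> \<nu>" using assms(3,4) by blast+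
  have "(p + 1, q + 1) \<notin> \<nu>"
    using partition_down[OF part(1), of "p + 1" "q + 1" p q] notin pos by auto
  then have new: "(p + 1, q + 1) \<notin> \<kappa> \<union> \<rho>" unfolding \<kappa> \<rho> by simp
  have "is_partition (insert (p + 1, q + 1) (\<kappa> \<union> \<rho>))"
    by (rule partition_insert[OF partition_Un[OF part(2,3)]]) (use mem in auto)
  then have \<tau>p: "is_partition \<tau>" using \<tau> by simp
  have "\<tau> - \<kappa> = {(p + 1, q), (p + 1, q + 1)}" using new notin unfolding \<tau> \<kappa> \<rho> by auto
  moreover have "\<tau> - \<rho> = {(p, q + 1), (p + 1, q + 1)}" using new notin unfolding \<tau> \<kappa> \<rho> by auto
  moreover have "\<kappa> \<subset> \<tau>" "\<rho> \<subset> \<tau>" using new unfolding \<tau> by blast+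
  ultimately show ?thesis
    using \<tau>p part new by (auto simp: less_d_def is_domino_def horizontal_domino_def vertical_domino_def)
qed

text \<open>The condition on nonzero \<open>x\<close> is the applicability condition of rules (1)
  and (2). The two final equivalences say that a trivial step passes unchanged to the opposite side
  of the square unless a nonzero entry stops it; they drive the induction over the array.\<close>

lemma local_rule_forward:
  assumes part: "is_partition \<nu>" and le: "\<nu> \<le>\<^sub>d \<kappa>" "\<nu> \<le>\<^sub>d \<rho>"
    and x: "x \<in> {1, -1, 0}" "x \<noteq> 0 \<Longrightarrow> \<nu> = \<kappa> \<and> \<nu> = \<rho>"
  obtains \<tau> where "local_rule x \<nu> \<kappa> \<rho> \<tau>" "\<And>\<tau>'. local_rule x \<nu> \<kappa> \<rho> \<tau>' \<Longrightarrow> \<tau>' = \<tau>"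
    "\<kappa> \<le>\<^sub>d \<tau>" "\<rho> \<le>\<^sub>d \<tau>" "\<kappa> = \<tau> \<longleftrightarrow> \<nu> = \<rho> \<and> x = 0" "\<rho> = \<tau> \<longleftrightarrow> \<nu> = \<kappa> \<and> x = 0"
proof (cases "x = 0")
  case False
  then have eq: "\<nu> = \<kappa>" "\<nu> = \<rho>" using x by auto
  show ?thesis
  proof (cases "x = 1")
    case True
    have "\<kappa> <\<^sub>d add_horizontal \<kappa> 1" using add_horizontal_first_row part eq by blast
    moreover from this have "\<kappa> \<noteq> add_horizontal \<kappa> 1" by (metis less_d_irrefl)
    ultimately show ?thesis
      using True eq local_rule_pos[of \<nu> \<kappa> \<rho>] by (intro that[of "add_horizontal \<kappa> 1"]) (auto simp: le_d_def)
  next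
    case False
    then have x: "x = -1" using x \<open>x \<noteq> 0\<close> by auto
    have "\<kappa> <\<^sub>d add_vertical \<kappa> 1" using add_vertical_first_column part eq by blast
    moreover from this have "\<kappa> \<noteq> add_vertical \<kappa> 1" by (metis less_d_irrefl)
    ultimately show ?thesis
      using x eq local_rule_neg[of \<nu> \<kappa> \<rho>] by (intro that[of "add_vertical \<kappa> 1"]) (auto simp: le_d_def)
  qed
next
  case zero: True
  consider "\<nu> = \<kappa>" | "\<nu> = \<rho>" | "\<nu> <\<^sub>d \<kappa>" "\<nu> <\<^sub>d \<rho>" using le by (auto simp: le_d_def)
  then show ?thesis
  proof cases
    case 1
    then show ?thesis
      using le zero local_rule_zero_left[OF le_d_subset[OF le(2)]]
      by (intro that[of \<rho>]) (auto simp: le_d_def)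
  next
    case 2
    then show ?thesis
      using le zero local_rule_zero_right[OF le_d_subset[OF le(1)]]
      by (intro that[of \<kappa>]) (auto simp: le_d_def)
  next
    case 3
    have sub: "\<nu> \<subseteq> \<kappa>" "\<nu> \<subseteq> \<rho>" and ne: "\<nu> \<noteq> \<kappa>" "\<nu> \<noteq> \<rho>"
      using 3 less_d_subset by auto
    note char = local_rule_zero_proper[OF 3]
    \<comment> \<open>With both given steps strict, the new ones are strict too, so both sides of
      the two equivalences are false.\<close>
    have "\<exists>\<tau>. local_rule 0 \<nu> \<kappa> \<rho> \<tau> \<and> (\<forall>\<tau>'. local_rule 0 \<nu> \<kappa> \<rho> \<tau>' \<longrightarrow> \<tau>' = \<tau>) \<and> \<kappa> <\<^sub>d \<tau> \<and> \<rho> <\<^sub>d \<tau>"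
    proof (cases "\<kappa> = \<rho>")
      case True
      have "is_domino (\<kappa> - \<nu>)" using 3 by (simp add: less_d_def)
      then consider r where "horizontal_domino r (\<kappa> - \<nu>)" | c where "vertical_domino c (\<kappa> - \<nu>)"
        by (auto simp: is_domino_def)
      then show ?thesis
      proof cases
        case (1 r)
        show ?thesis
        proof (intro exI[of _ "add_horizontal \<kappa> (r + 1)"] conjI allI impI)
          show "\<tau>' = add_horizontal \<kappa> (r + 1)" if "local_rule 0 \<nu> \<kappa> \<rho> \<tau>'" for \<tau>'
            using that 1 unfolding char
            by (metis True horizontal_domino_row_unique not_horizontal_and_vertical)
        qed (use add_horizontal_next_row[OF 3(1) 1] True 1 char in blast)+
      next
        case (2 c)
        show ?thesis
        proof (intro exI[of _ "add_vertical \<kappa> (c + 1)"] conjI allI impI)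
          show "\<tau>' = add_vertical \<kappa> (c + 1)" if "local_rule 0 \<nu> \<kappa> \<rho> \<tau>'" for \<tau>'
            using that 2 unfolding char
            by (metis True vertical_domino_column_unique not_horizontal_and_vertical)
        qed (use add_vertical_next_column[OF 3(1) 2] True 2 char in blast)+
      qed
    next
      case False
      show ?thesis
      proof (cases "(\<kappa> - \<nu>) \<inter> (\<rho> - \<nu>) = {}")
        case True
        \<comment> \<open>Disjoint dominoes simply change places.\<close>
        have "\<kappa> \<union> \<rho> - \<kappa> = \<rho> - \<nu>" "\<kappa> \<union> \<rho> - \<rho> = \<kappa> - \<nu>" using True sub by blast+
        moreover have "\<kappa> \<subset> \<kappa> \<union> \<rho>" "\<rho> \<subset> \<kappa> \<union> \<rho>" using True sub ne by blast+
        ultimately have "\<kappa> <\<^sub>d \<kappa> \<union> \<rho>" "\<rho> <\<^sub>d \<kappa> \<union> \<rho>"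
          using 3 partition_Un by (auto simp: less_d_def)
        then show ?thesis using False True unfolding char by blast
      next
        case overlap: False
        from 3 False overlap show ?thesis
        proof (cases rule: overlap_above)
          case (hv p q)
          then have "(\<kappa> - \<nu>) \<inter> (\<rho> - \<nu>) = {(p, q)}" by auto
          then show ?thesis
            using local_rule_zero_overlap[OF 3 hv refl] False unfolding char by auto
        next
          case (vh p q)
          then have "(\<kappa> - \<nu>) \<inter> (\<rho> - \<nu>) = {(p, q)}" by auto
          then show ?thesis
            using local_rule_zero_overlap[OF 3(2,1) vh(2,1) refl] False unfolding char
            by (auto simp: Un_commute)
        qed
      qed
    qed
    then obtain \<tau> where \<tau>: "local_rule 0 \<nu> \<kappa> \<rho> \<tau>" "\<And>\<tau>'. local_rule 0 \<nu> \<kappa> \<rho> \<tau>' \<Longrightarrow> \<tau>' = \<tau>"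
      "\<kappa> <\<^sub>d \<tau>" "\<rho> <\<^sub>d \<tau>" by blast
    have "\<kappa> \<noteq> \<tau>" "\<rho> \<noteq> \<tau>" using \<tau>(3,4) by auto
    then show ?thesis
      using zero ne \<tau>(3,4) by (intro that[OF \<tau>(1,2)[folded zero]]) (auto simp: le_d_def)
  qed
qed

lemma local_rule_entry: "local_rule x \<nu> \<kappa> \<rho> \<tau> \<Longrightarrow> x \<in> {1, -1, 0} \<and> (x \<noteq> 0 \<longrightarrow> \<nu> = \<kappa> \<and> \<nu> = \<rho>)"
  by (auto elim: local_rule.cases)

lemma local_rule_edges:
  assumes "is_partition \<nu>" "\<nu> \<le>\<^sub>d \<kappa>" "\<nu> \<le>\<^sub>d \<rho>" "local_rule x \<nu> \<kappa> \<rho> \<tau>"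
  shows "\<kappa> \<le>\<^sub>d \<tau>" "\<rho> \<le>\<^sub>d \<tau>" "\<kappa> = \<tau> \<longleftrightarrow> \<nu> = \<rho> \<and> x = 0" "\<rho> = \<tau> \<longleftrightarrow> \<nu> = \<kappa> \<and> x = 0"
proof -
  from assms(4) have x: "x \<in> {1, -1, 0}" "x \<noteq> 0 \<Longrightarrow> \<nu> = \<kappa> \<and> \<nu> = \<rho>" using local_rule_entry by auto
  obtain \<sigma> where s: "\<And>\<tau>'. local_rule x \<nu> \<kappa> \<rho> \<tau>' \<Longrightarrow> \<tau>' = \<sigma>"
    "\<kappa> \<le>\<^sub>d \<sigma>" "\<rho> \<le>\<^sub>d \<sigma>" "\<kappa> = \<sigma> \<longleftrightarrow> \<nu> = \<rho> \<and> x = 0" "\<rho> = \<sigma> \<longleftrightarrow> \<nu> = \<kappa> \<and> x = 0"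
    using local_rule_forward[OF assms(1-3) x] by metis
  have "\<tau> = \<sigma>" using s(1)[OF assms(4)] .
  then show "\<kappa> \<le>\<^sub>d \<tau>" "\<rho> \<le>\<^sub>d \<tau>" "\<kappa> = \<tau> \<longleftrightarrow> \<nu> = \<rho> \<and> x = 0" "\<rho> = \<tau> \<longleftrightarrow> \<nu> = \<kappa> \<and> x = 0"
    using s(2-5) by auto
qed

section \<open>Recovering the upper left corner\<close>

text \<open>The overlap of \<open>\<tau> / \<kappa>\<close> and \<open>\<tau> / \<rho>\<close> is empty under rule (3b); under rule (3c) it is the cell added
  diagonally after the overlap of \<open>\<kappa> / \<nu>\<close> and \<open>\<rho> / \<nu>\<close>. One formula for \<open>\<nu>\<close> thus covers both rules.\<close>

lemma local_rule_corner_distinct: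
  assumes "is_partition \<nu>" "\<nu> \<le>\<^sub>d \<kappa>" "\<nu> \<le>\<^sub>d \<rho>" "local_rule x \<nu> \<kappa> \<rho> \<tau>" "\<kappa> \<noteq> \<tau>" "\<rho> \<noteq> \<tau>" "\<kappa> \<noteq> \<rho>"
  shows "x = 0 \<and> \<nu> = {c \<in> \<kappa> \<inter> \<rho>. (fst c + 1, snd c + 1) \<notin> (\<tau> - \<kappa>) \<inter> (\<tau> - \<rho>)}"
proof -
  have x: "x = 0" using local_rule_entry[OF assms(4)] assms(7) by auto
  then have lt: "\<nu> <\<^sub>d \<kappa>" "\<nu> <\<^sub>d \<rho>"
    using local_rule_edges[OF assms(1-4)] assms by (auto simp: le_d_def)
  have sub: "\<nu> \<subseteq> \<kappa>" "\<nu> \<subseteq> \<rho>" using lt less_d_subset by auto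
  consider "(\<kappa> - \<nu>) \<inter> (\<rho> - \<nu>) = {}" "\<tau> = \<kappa> \<union> \<rho>"
    | p q where "(\<kappa> - \<nu>) \<inter> (\<rho> - \<nu>) = {(p, q)}" "\<tau> = \<kappa> \<union> \<rho> \<union> {(p + 1, q + 1)}"
    using assms(4,7) unfolding x local_rule_zero_proper[OF lt] by blast
  then show ?thesis
  proof cases
    case 1
    then show ?thesis using x sub by blast
  next
    case (2 p q)
    have "(\<kappa> - \<nu>) \<inter> (\<rho> - \<nu>) \<noteq> {}" using 2(1) by simp
    with lt assms(7) have "(p + 1, q + 1) \<notin> \<kappa> \<union> \<rho>"
    proof (cases rule: overlap_above)
      case (hv i j)
      then have "i = p" "j = q" using 2(1) by auto
      then show ?thesis using local_rule_zero_overlap[OF lt hv refl] by simp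
    next
      case (vh i j)
      then have "i = p" "j = q" using 2(1) by auto
      then show ?thesis using local_rule_zero_overlap[OF lt(2,1) vh(2,1) refl] by simp
    qed
    then have "(\<tau> - \<kappa>) \<inter> (\<tau> - \<rho>) = {(p + 1, q + 1)}" using 2 by blast
    then have "(fst c + 1, snd c + 1) \<in> (\<tau> - \<kappa>) \<inter> (\<tau> - \<rho>) \<longleftrightarrow> c = (p, q)" for c
      by (cases c) simp
    moreover have "\<nu> = {c \<in> \<kappa> \<inter> \<rho>. c \<noteq> (p, q)}" using sub 2 by blast
    ultimately show ?thesis using x by simp
  qed
qed

text \<open>The four outcomes are told apart by \<tau> / \<kappa> alone: horizontal in row 1,
  vertical in column 1, horizontal in a later row, vertical in a later column. The bounds
  \<open>r\<ge>1\<close> and \<open>c\<ge>1\<close> are what separates the last two from the first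
  two.\<close>

lemma local_rule_corner_equal:
  assumes "is_partition \<nu>" "\<nu> \<le>\<^sub>d \<kappa>" "local_rule x \<nu> \<kappa> \<kappa> \<tau>" "\<kappa> \<noteq> \<tau>"
  shows "x = 1 \<and> \<nu> = \<kappa> \<and> horizontal_domino 1 (\<tau> - \<kappa>) \<or>
    x = -1 \<and> \<nu> = \<kappa> \<and> vertical_domino 1 (\<tau> - \<kappa>) \<or>
    x = 0 \<and> \<nu> <\<^sub>d \<kappa> \<and> (\<exists>r\<ge>1. horizontal_domino r (\<kappa> - \<nu>) \<and> horizontal_domino (r + 1) (\<tau> - \<kappa>)) \<or>
    x = 0 \<and> \<nu> <\<^sub>d \<kappa> \<and> (\<exists>c\<ge>1. vertical_domino c (\<kappa> - \<nu>) \<and> vertical_domino (c + 1) (\<tau> - \<kappa>))"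
proof -
  consider "x = 1" | "x = -1" | "x = 0" using local_rule_entry[OF assms(3)] by auto
  then show ?thesis
  proof cases
    case 1
    then show ?thesis using assms add_horizontal_first_row[of \<kappa>] by (auto simp: local_rule_pos)
  next
    case 2
    then show ?thesis using assms add_vertical_first_column[of \<kappa>] by (auto simp: local_rule_neg)
  next
    case 3
    then have lt: "\<nu> <\<^sub>d \<kappa>"
      using local_rule_edges[OF assms(1,2,2,3)] assms by (auto simp: le_d_def)
    have pos: "1 \<le> i \<and> 1 \<le> j" if "(i, j) \<in> \<kappa> - \<nu>" for i j
      using partition_pos[of \<kappa> i j] less_d_partition[OF lt] that by auto
    from assms(3) consider r where "horizontal_domino r (\<kappa> - \<nu>)" "\<tau> = add_horizontal \<kappa> (r + 1)"
      | c where "vertical_domino c (\<kappa> - \<nu>)" "\<tau> = add_vertical \<kappa> (c + 1)"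
      unfolding 3 local_rule_zero_proper[OF lt lt] by blast
    then show ?thesis
    proof cases
      case (1 r)
      moreover from 1(1) pos have "1 \<le> r" by (auto simp: horizontal_domino_def)
      ultimately show ?thesis using add_horizontal_next_row[OF lt 1(1)] 3 lt by blast
    next
      case (2 c)
      moreover from 2(1) pos have "1 \<le> c" by (auto simp: vertical_domino_def)
      ultimately show ?thesis using add_vertical_next_column[OF lt 2(1)] 3 lt by blast
    qed
  qed
qed

text \<open>A trivial side forces \<open>x = 0\<close> and makes \<nu> equal to the other given
  corner. With both sides strict, \<nu> is read off from the overlap formula if \<kappa> \<noteq>
  \<rho>, and from the orientation and the row or column of \<tau> / \<kappa> if \<kappa> =
  \<rho>.\<close>

lemma local_rule_backward_unique:
  assumes "is_partition \<nu>" "\<nu> \<le>\<^sub>d \<kappa>" "\<nu> \<le>\<^sub>d \<rho>" "local_rule x \<nu> \<kappa> \<rho> \<tau>"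
    and "is_partition \<nu>'" "\<nu>' \<le>\<^sub>d \<kappa>" "\<nu>' \<le>\<^sub>d \<rho>" "local_rule x' \<nu>' \<kappa> \<rho> \<tau>"
  shows "x = x' \<and> \<nu> = \<nu>'"
proof -
  consider "\<kappa> = \<tau>" | "\<rho> = \<tau>" | "\<kappa> \<noteq> \<tau>" "\<rho> \<noteq> \<tau>" "\<kappa> \<noteq> \<rho>" | "\<kappa> = \<rho>" "\<kappa> \<noteq> \<tau>" by blast
  then show ?thesis
  proof cases
    case 1
    then show ?thesis using local_rule_edges(3)[OF assms(1-4)] local_rule_edges(3)[OF assms(5-8)] by blast
  next
    case 2
    then show ?thesis using local_rule_edges(4)[OF assms(1-4)] local_rule_edges(4)[OF assms(5-8)] by blast
  next
    case 3
    then show ?thesis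
      using local_rule_corner_distinct[OF assms(1-4) 3] local_rule_corner_distinct[OF assms(5-8) 3] by simp
  next
    case 4
    define D where "D = \<tau> - \<kappa>"
    note c = local_rule_corner_equal[OF assms(1,2) assms(4)[folded 4(1)] 4(2), folded D_def]
    note c' = local_rule_corner_equal[OF assms(5,6) assms(8)[folded 4(1)] 4(2), folded D_def]
    have H: "horizontal_domino r D \<Longrightarrow> horizontal_domino s D \<Longrightarrow> r = s" for r s
      by (rule horizontal_domino_row_unique)
    have V: "vertical_domino r D \<Longrightarrow> vertical_domino s D \<Longrightarrow> r = s" for r s
      by (rule vertical_domino_column_unique)
    have HV: "horizontal_domino r D \<Longrightarrow> vertical_domino s D \<Longrightarrow> False" for r s
      by (rule not_horizontal_and_vertical)
    from c show ?thesis
    proof (elim disjE conjE exE)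
      assume a: "x = 1" "\<nu> = \<kappa>" "horizontal_domino 1 D"
      from c' show ?thesis
        by (elim disjE conjE exE) (use a in \<open>auto dest: H[OF a(3)] HV[OF a(3)]\<close>)
    next
      assume a: "x = -1" "\<nu> = \<kappa>" "vertical_domino 1 D"
      from c' show ?thesis
        by (elim disjE conjE exE) (use a in \<open>auto dest: V[OF a(3)] HV[OF _ a(3)]\<close>)
    next
      fix r assume a: "x = 0" "\<nu> <\<^sub>d \<kappa>" "1 \<le> r" "horizontal_domino r (\<kappa> - \<nu>)" "horizontal_domino (r + 1) D"
      from c' have "x' = 0 \<and> \<nu>' <\<^sub>d \<kappa> \<and> horizontal_domino r (\<kappa> - \<nu>')"
        by (elim disjE conjE exE) (use a(3) in \<open>auto dest: H[OF a(5)] HV[OF a(5)]\<close>)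
      then show ?thesis using a horizontal_predecessor_unique by blast
    next
      fix r assume a: "x = 0" "\<nu> <\<^sub>d \<kappa>" "1 \<le> r" "vertical_domino r (\<kappa> - \<nu>)" "vertical_domino (r + 1) D"
      from c' have "x' = 0 \<and> \<nu>' <\<^sub>d \<kappa> \<and> vertical_domino r (\<kappa> - \<nu>')"
        by (elim disjE conjE exE) (use a(3) in \<open>auto dest: V[OF a(5)] HV[OF _ a(5)]\<close>)
      then show ?thesis using a vertical_predecessor_unique by blast
    qed
  qed
qed

text \<open>Undoes rule (3c): besides intersecting \<kappa> and \<rho>, the cell
  \<open>(p, q)\<close> is deleted. It is a corner of the intersection because \<kappa> lacks the
  cell below it and \<rho> the cell to its right.\<close>

lemma local_rule_backward_overlap:
  assumes lt: "\<kappa> <\<^sub>d \<tau>" "\<rho> <\<^sub>d \<tau>"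
    and diff: "\<tau> - \<kappa> = {(p + 1, q), (p + 1, q + 1)}" "\<tau> - \<rho> = {(p, q + 1), (p + 1, q + 1)}"
  obtains \<nu> where "\<nu> <\<^sub>d \<kappa>" "\<nu> <\<^sub>d \<rho>" "(\<kappa> - \<nu>) \<inter> (\<rho> - \<nu>) = {(p, q)}" "\<tau> = \<kappa> \<union> \<rho> \<union> {(p + 1, q + 1)}"
proof -
  have part: "is_partition \<tau>" "is_partition \<kappa>" "is_partition \<rho>" using lt less_d_partition by auto
  have sub: "\<kappa> \<subseteq> \<tau>" "\<rho> \<subseteq> \<tau>" using lt less_d_subset by auto
  have mem: "(p + 1, q) \<in> \<tau> - \<kappa>" "(p, q + 1) \<in> \<tau> - \<rho>" "(p + 1, q + 1) \<in> \<tau>"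
    using diff by blast+
  have pos: "1 \<le> p" "1 \<le> q" using partition_pos[OF part(1)] mem by blast+
  have "(p, q) \<in> \<tau>" using partition_down[OF part(1) mem(3), of p q] pos by simp
  moreover have "(p, q) \<notin> \<tau> - \<kappa>" "(p, q) \<notin> \<tau> - \<rho>" unfolding diff by auto
  ultimately have in_both: "(p, q) \<in> \<kappa>" "(p, q) \<in> \<rho>" by auto
  have "(p, q + 1) \<notin> \<tau> - \<kappa>" "(p + 1, q) \<notin> \<tau> - \<rho>" unfolding diff by auto
  then have in_one: "(p, q + 1) \<in> \<kappa>" "(p + 1, q) \<in> \<rho>" using mem by auto
  define \<nu> where "\<nu> = \<kappa> \<inter> \<rho> - {(p, q)}"
  have "is_partition \<nu>"
    unfolding \<nu>_def by (rule partition_remove[OF partition_Int[OF part(2,3)]]) (use mem in auto)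
  moreover have \<kappa>: "\<kappa> - \<nu> = {(p, q), (p, q + 1)}"
  proof -
    have "\<kappa> - \<nu> = (\<kappa> \<inter> (\<tau> - \<rho>)) \<union> {(p, q)}" using sub in_both by (auto simp: \<nu>_def)
    moreover have "(p + 1, q + 1) \<notin> \<kappa>" using diff by auto
    ultimately show ?thesis using in_one unfolding diff by auto
  qed
  moreover have \<rho>: "\<rho> - \<nu> = {(p, q), (p + 1, q)}"
  proof -
    have "\<rho> - \<nu> = (\<rho> \<inter> (\<tau> - \<kappa>)) \<union> {(p, q)}" using sub in_both by (auto simp: \<nu>_def)
    moreover have "(p + 1, q + 1) \<notin> \<rho>" using diff by auto
    ultimately show ?thesis using in_one unfolding diff by auto
  qed
  moreover have "\<nu> \<subset> \<kappa>" "\<nu> \<subset> \<rho>" using in_both by (auto simp: \<nu>_def)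
  ultimately have "\<nu> <\<^sub>d \<kappa>" "\<nu> <\<^sub>d \<rho>"
    using part by (auto simp: less_d_def is_domino_def horizontal_domino_def vertical_domino_def)
  moreover have "(\<kappa> - \<nu>) \<inter> (\<rho> - \<nu>) = {(p, q)}" unfolding \<kappa> \<rho> by auto
  moreover have "\<tau> = \<kappa> \<union> \<rho> \<union> {(p + 1, q + 1)}"
  proof -
    have "\<tau> = \<kappa> \<union> {(p + 1, q), (p + 1, q + 1)}" using diff(1) sub(1) by blast
    then show ?thesis using sub(2) in_one(2) mem(3) by blast
  qed
  ultimately show thesis using that by blast
qed

lemma local_rule_backward:
  assumes part: "is_partition \<tau>" and le: "\<kappa> \<le>\<^sub>d \<tau>" "\<rho> \<le>\<^sub>d \<tau>"
  obtains x \<nu> where "\<nu> \<le>\<^sub>d \<kappa>" "\<nu> \<le>\<^sub>d \<rho>" "local_rule x \<nu> \<kappa> \<rho> \<tau>"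
proof -
  consider "\<kappa> = \<tau>" | "\<rho> = \<tau>" | "\<kappa> <\<^sub>d \<tau>" "\<rho> <\<^sub>d \<tau>" "\<kappa> \<noteq> \<rho>" | "\<kappa> <\<^sub>d \<tau>" "\<kappa> = \<rho>"
    using le by (auto simp: le_d_def)
  then show thesis
  proof cases
    case 1
    then show thesis using le local_rule_zero_right[OF le_d_subset[OF le(2)]] that[of \<rho> 0] by (auto simp: le_d_def)
  next
    case 2
    then show thesis using le local_rule_zero_left[OF le_d_subset[OF le(1)]] that[of \<kappa> 0] by (auto simp: le_d_def)
  next
    case 3
    show thesis
    proof (cases "(\<tau> - \<kappa>) \<inter> (\<tau> - \<rho>) = {}")
      case True
      have sub: "\<kappa> \<subset> \<tau>" "\<rho> \<subset> \<tau>" using 3 by (auto simp: less_d_def)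
      have "\<kappa> - \<kappa> \<inter> \<rho> = \<tau> - \<rho>" "\<rho> - \<kappa> \<inter> \<rho> = \<tau> - \<kappa>" using True sub by blast+
      moreover have "\<kappa> \<inter> \<rho> \<subset> \<kappa>" "\<kappa> \<inter> \<rho> \<subset> \<rho>" using True sub by blast+
      ultimately have lt: "\<kappa> \<inter> \<rho> <\<^sub>d \<kappa>" "\<kappa> \<inter> \<rho> <\<^sub>d \<rho>"
        using 3 partition_Int by (auto simp: less_d_def)
      moreover have "local_rule 0 (\<kappa> \<inter> \<rho>) \<kappa> \<rho> (\<kappa> \<union> \<rho>)"
        by (rule rule_3b[OF lt 3(3)]) blast
      moreover have "\<kappa> \<union> \<rho> = \<tau>" using True sub by blast
      ultimately show thesis using that[of "\<kappa> \<inter> \<rho>" 0] by (simp add: le_d_def)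
    next
      case False
      from 3 False show thesis
      proof (cases rule: overlap_below)
        case (hv p q)
        then obtain \<nu> where \<nu>: "\<nu> <\<^sub>d \<kappa>" "\<nu> <\<^sub>d \<rho>" "(\<kappa> - \<nu>) \<inter> (\<rho> - \<nu>) = {(p, q)}"
          "\<tau> = \<kappa> \<union> \<rho> \<union> {(p + 1, q + 1)}" using local_rule_backward_overlap[OF 3(1,2)] by metis
        show thesis
          by (rule that[of \<nu> 0]) (use rule_3c[OF \<nu>(1,2) 3(3) \<nu>(3)] \<nu> in \<open>auto simp: le_d_def\<close>)
      next
        case (vh p q)
        then obtain \<nu> where \<nu>: "\<nu> <\<^sub>d \<rho>" "\<nu> <\<^sub>d \<kappa>" "(\<rho> - \<nu>) \<inter> (\<kappa> - \<nu>) = {(p, q)}"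
          "\<tau> = \<rho> \<union> \<kappa> \<union> {(p + 1, q + 1)}" using local_rule_backward_overlap[OF 3(2,1)] by metis
        have "(\<kappa> - \<nu>) \<inter> (\<rho> - \<nu>) = {(p, q)}" "\<tau> = \<kappa> \<union> \<rho> \<union> {(p + 1, q + 1)}" using \<nu> by blast+
        then show thesis
          by (intro that[of \<nu> 0]) (use rule_3c[OF \<nu>(2,1) 3(3)] \<nu>(1,2) in \<open>auto simp: le_d_def\<close>)
      qed
    qed
  next
    case 4
    have \<kappa>: "is_partition \<kappa>" using 4 less_d_partition by blast
    have "is_domino (\<tau> - \<kappa>)" using 4 by (simp add: less_d_def)
    then consider r where "horizontal_domino r (\<tau> - \<kappa>)" | c where "vertical_domino c (\<tau> - \<kappa>)"
      by (auto simp: is_domino_def)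
    then show thesis
    proof cases
      case (1 r)
      then obtain q where q: "\<tau> - \<kappa> = {(r, q), (r, q + 1)}" by (auto simp: horizontal_domino_def)
      then have mem: "(r, q) \<in> \<tau>" "(r, q) \<notin> \<kappa>" by blast+
      have pos: "1 \<le> r" "1 \<le> q" using partition_pos[OF part mem(1)] by auto
      show thesis
      \<comment> \<open>In the first row there is no previous row from which (3d) could have moved
        the domino, so the entry is 1 and \<nu> = \<kappa>.\<close>
      proof (cases "r = 1")
        case True
        have "(1, q - 1) \<in> \<tau>" if "q \<noteq> 1"
          using partition_down[OF part mem(1), of 1 "q - 1"] pos that True by simp
        moreover have eq: "\<tau> = \<kappa> \<union> {(1, q), (1, q + 1)}" using q True less_d_subset[OF 4(1)] by blast
        ultimately have left: "q = 1 \<or> (1, q - 1) \<in> \<kappa>" using pos by (cases q) auto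
        have "\<tau> = add_horizontal \<kappa> 1"
          using add_horizontal_eq[OF \<kappa> _ _ pos(2) left] mem True eq by simp
        then show thesis using 4 by (intro that[of \<kappa> 1]) (auto simp: le_d_def local_rule_pos)
      next
        case False
        then obtain s where s: "r = s + 1" "1 \<le> s" using pos by (cases r) auto
        obtain \<nu> where \<nu>: "\<nu> <\<^sub>d \<kappa>" "horizontal_domino s (\<kappa> - \<nu>)" "\<tau> = add_horizontal \<kappa> (s + 1)"
          using horizontal_predecessor[OF 4(1) 1[unfolded s(1)] s(2)] .
        show thesis
          by (rule that[of \<nu> 0]) (use rule_3d[OF \<nu>(1) refl \<nu>(2)] \<nu> 4 in \<open>auto simp: le_d_def\<close>)
      qed
    next
      case (2 c)
      then obtain q where q: "\<tau> - \<kappa> = {(q, c), (q + 1, c)}" by (auto simp: vertical_domino_def)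
      then have mem: "(q, c) \<in> \<tau>" "(q, c) \<notin> \<kappa>" by blast+
      have pos: "1 \<le> q" "1 \<le> c" using partition_pos[OF part mem(1)] by auto
      show thesis
      \<comment> \<open>Likewise a vertical domino in the first column can come only from the entry
        -1.\<close>
      proof (cases "c = 1")
        case True
        have "(q - 1, 1) \<in> \<tau>" if "q \<noteq> 1"
          using partition_down[OF part mem(1), of "q - 1" 1] pos that True by simp
        moreover have eq: "\<tau> = \<kappa> \<union> {(q, 1), (q + 1, 1)}" using q True less_d_subset[OF 4(1)] by blast
        ultimately have above: "q = 1 \<or> (q - 1, 1) \<in> \<kappa>" using pos by (cases q) auto
        have "\<tau> = add_vertical \<kappa> 1"
          using add_vertical_eq[OF \<kappa> _ _ pos(1) above] mem True eq by simp
        then show thesis using 4 by (intro that[of \<kappa> "-1"]) (auto simp: le_d_def local_rule_neg)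
      next
        case False
        then obtain s where s: "c = s + 1" "1 \<le> s" using pos by (cases c) auto
        obtain \<nu> where \<nu>: "\<nu> <\<^sub>d \<kappa>" "vertical_domino s (\<kappa> - \<nu>)" "\<tau> = add_vertical \<kappa> (s + 1)"
          using vertical_predecessor[OF 4(1) 2[unfolded s(1)] s(2)] .
        show thesis
          by (rule that[of \<nu> 0]) (use rule_3e[OF \<nu>(1) refl \<nu>(2)] \<nu> 4 in \<open>auto simp: le_d_def\<close>)
      qed
    qed
  qed
qed

section \<open>Tableaux and multichains\<close>

text \<open>The number of dominoes is existentially bound in \<open>SDT\<close>. The cardinality of
  the skew shape determines it, so any known size may be used.\<close>

lemma SDTD:
  assumes "T \<in> SDT l mu" "skew_of_size l mu (2 * n)"
  shows "bij_betw T (l - mu) {1..2 * n}"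
    and "c \<notin> l - mu \<Longrightarrow> T c = 0"
    and "(i, j) \<in> l - mu \<Longrightarrow> (i', j') \<in> l - mu \<Longrightarrow> i \<le> i' \<Longrightarrow> j \<le> j' \<Longrightarrow> T (i, j) \<le> T (i', j')"
    and "k \<in> {1..n} \<Longrightarrow> is_domino (domino_of T k)"
proof -
  obtain n' where n': "skew_of_size l mu (2 * n')" "bij_betw T (l - mu) {1..2 * n'}"
    "\<forall>c. c \<notin> l - mu \<longrightarrow> T c = 0"
    "\<forall>(i, j) \<in> l - mu. \<forall>(i', j') \<in> l - mu. i \<le> i' \<and> j \<le> j' \<longrightarrow> T (i, j) \<le> T (i', j')"
    "\<forall>k \<in> {1..n'}. is_domino (domino_of T k)"
    using assms(1) unfolding SDT_def by blast
  have eq: "n' = n" using n'(1) assms(2) by (simp add: skew_of_size_def)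
  show "bij_betw T (l - mu) {1..2 * n}" using n'(2) unfolding eq .
  show "T c = 0" if "c \<notin> l - mu" using n'(3) that by blast
  show "T (i, j) \<le> T (i', j')" if "(i, j) \<in> l - mu" "(i', j') \<in> l - mu" "i \<le> i'" "j \<le> j'"
    using bspec[OF n'(4) that(1)] that by auto
  show "is_domino (domino_of T k)" if "k \<in> {1..n}" using n'(5) that unfolding eq by blast
qed

lemma SDTI:
  assumes "skew_of_size l mu (2 * n)" "bij_betw T (l - mu) {1..2 * n}" "\<And>c. c \<notin> l - mu \<Longrightarrow> T c = 0"
    "\<And>i j i' j'. (i, j) \<in> l - mu \<Longrightarrow> (i', j') \<in> l - mu \<Longrightarrow> i \<le> i' \<Longrightarrow> j \<le> j' \<Longrightarrow> T (i, j) \<le> T (i', j')"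
    "\<And>k. k \<in> {1..n} \<Longrightarrow> is_domino (domino_of T k)"
  shows "T \<in> SDT l mu"
  unfolding SDT_def using assms by blast

lemma SDT_skew: "T \<in> SDT l mu \<Longrightarrow> \<exists>n. skew_of_size l mu (2 * n)"
  by (auto simp: SDT_def)

text \<open>The default value 0 lets a tableau reveal its own shape; this is later what makes \<mu>
  a function of \<beta> and \<open>U\<close>.\<close>

lemma SDT_support:
  assumes "T \<in> SDT l mu"
  shows "c \<in> l - mu \<longleftrightarrow> 1 \<le> T c"
proof -
  obtain n where n: "skew_of_size l mu (2 * n)" using SDT_skew[OF assms] ..
  show ?thesis
    using SDTD(2)[OF assms n, of c] bij_betwE[OF SDTD(1)[OF assms n]] by (cases "c \<in> l - mu") auto
qed

section \<open>From tableaux to multichains\<close>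

text \<open>\<open>card ({1..k} - Z)\<close> counts the nontrivial steps up to \<open>k\<close>,
  hence is the label of the domino added in a nontrivial step \<open>k\<close>.\<close>

lemma card_steps_Suc:
  "card ({1..Suc k} - Z) = (if Suc k \<in> Z then card ({1..k} - Z) else Suc (card ({1..k} - Z)))"
proof (cases "Suc k \<in> Z")
  case True
  then have "{1..Suc k} - Z = {1..k} - Z" by (auto simp: le_Suc_eq)
  then show ?thesis using True by simp
next
  case False
  then have "{1..Suc k} - Z = insert (Suc k) ({1..k} - Z)" by (auto simp: le_Suc_eq)
  then show ?thesis using False by simp
qed

text \<open>Every label occurs at some nontrivial step, so a multichain prescribes all dominoes of
  its tableau.\<close>

lemma card_steps_surj:
  fixes N :: nat
  shows "t \<in> {1..card ({1..N} - Z)} \<Longrightarrow> \<exists>k\<in>{1..N}. k \<notin> Z \<and> card ({1..k} - Z) = t"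
proof (induction N)
  case (Suc N)
  show ?case
  proof (cases "t \<le> card ({1..N} - Z)")
    case True
    then obtain k where "k \<in> {1..N}" "k \<notin> Z" "card ({1..k} - Z) = t" using Suc by auto
    then show ?thesis by (intro bexI[of _ k]) auto
  next
    case False
    then show ?thesis using Suc.prems by (intro bexI[of _ "Suc N"]) (auto simp only: card_steps_Suc split: if_splits, auto)
  qed
qed simp

lemma ball_shift:
  fixes P :: "nat \<Rightarrow> nat \<Rightarrow> bool"
  shows "(\<forall>k\<in>{1..N}. P (k - 1) k) \<longleftrightarrow> (\<forall>k<N. P k (Suc k))"
proof
  assume "\<forall>k<N. P k (Suc k)"
  then have "P (k - 1) k" if "k \<in> {1..N}" for k using that by (cases k) auto
  then show "\<forall>k\<in>{1..N}. P (k - 1) k" by blast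
qed force

lemma domino_multichain_Suc:
  "domino_multichain mu l N Z T C \<longleftrightarrow> C 0 = mu \<and> C N = l \<and>
     (\<forall>k<N. C k \<le>\<^sub>d C (Suc k) \<and> (C k = C (Suc k) \<longleftrightarrow> Suc k \<in> Z) \<and>
        (Suc k \<notin> Z \<longrightarrow> C (Suc k) - C k = domino_of T (Suc (card ({1..k} - Z)))))"
  unfolding domino_multichain_def
  by (subst ball_shift[of N "\<lambda>k' k. C k' \<le>\<^sub>d C k \<and> (C k' = C k \<longleftrightarrow> k \<in> Z) \<and>
        (k \<notin> Z \<longrightarrow> C k - C k' = domino_of T (card ({1..k} - Z)))"])
    (simp only: card_steps_Suc if_False cong: imp_cong)

lemma multichain_partition:
  "is_partition (C 0) \<Longrightarrow> \<forall>k<N. C k \<le>\<^sub>d C (Suc k) \<Longrightarrow> k \<le> N \<Longrightarrow> is_partition (C k)"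
  by (induction k) (auto simp: le_d_def less_d_def Suc_le_eq)

text \<open>Starting at \<open>mu\<close>, the set \<open>Z\<close> and the dominoes of
  \<open>T\<close> dictate each step. The upper ends \<open>l\<close> and \<open>l'\<close> are kept
  separate because, in the proof of injectivity, they are the final shapes of two arrays not yet
  known to agree.\<close>

lemma domino_multichain_unique:
  assumes "domino_multichain mu l N Z T C" "domino_multichain mu l' N Z T C'" "k \<le> N"
  shows "C k = C' k"
  using assms(3)
proof (induction k)
  case 0
  then show ?case using assms by (simp add: domino_multichain_def)
next
  case (Suc k)
  have step: "B (Suc k) = (if Suc k \<in> Z then B k else B k \<union> domino_of T (Suc (card ({1..k} - Z))))"
    if "domino_multichain mu b N Z T B" for B b
  proof -
    have "B k \<le>\<^sub>d B (Suc k)" "B k = B (Suc k) \<longleftrightarrow> Suc k \<in> Z"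
      "Suc k \<notin> Z \<Longrightarrow> B (Suc k) - B k = domino_of T (Suc (card ({1..k} - Z)))"
      using that Suc.prems unfolding domino_multichain_Suc by auto
    then show ?thesis using le_d_subset by fastforce
  qed
  show ?case using step[OF assms(1)] step[OF assms(2)] Suc by simp
qed

lemma SDT_multichain_exists:
  assumes T: "T \<in> SDT l mu" and size: "skew_of_size l mu (2 * card ({1..N} - Z))"
  shows "\<exists>C. domino_multichain mu l N Z T C"
proof -
  define n where "n = card ({1..N} - Z)"
  note T' = SDTD[OF T size[folded n_def]]
  have part: "is_partition l" "is_partition mu" "mu \<subseteq> l" using size by (auto simp: skew_of_size_def)
  \<comment> \<open>\<open>F t\<close> is \<open>mu\<close> together with the dominoes labelled 1 to
    \<open>t\<close>. It is a partition because \<open>T\<close> increases along rows and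
    columns.\<close>
  define F where "F t = mu \<union> {c \<in> l - mu. T c \<le> 2 * t}" for t
  have F: "is_partition (F t)" for t
  proof (rule partitionI)
    show "finite (F t)" using partition_finite[OF part(1)] part(3) by (auto simp: F_def intro: finite_subset)
    show "1 \<le> i \<and> 1 \<le> j" if "(i, j) \<in> F t" for i j
      using partition_pos[OF part(1), of i j] that part(3) by (auto simp: F_def)
    fix i j i' j' assume a: "(i, j) \<in> F t" "1 \<le> i'" "i' \<le> i" "1 \<le> j'" "j' \<le> j"
    show "(i', j') \<in> F t"
    proof (cases "(i', j') \<in> mu")
      case False
      then have ij: "(i, j) \<in> l - mu" "T (i, j) \<le> 2 * t"
        using a partition_down[OF part(2), of i j i' j'] by (auto simp: F_def)
      then have "(i', j') \<in> l - mu" using partition_down[OF part(1), of i j i' j'] a False by auto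
      then show ?thesis using T'(3)[of i' j' i j] ij a by (auto simp: F_def)
    qed (simp add: F_def)
  qed
  have diff: "F (Suc t) - F t = domino_of T (Suc t)" for t
  proof -
    have "c \<in> F (Suc t) - F t \<longleftrightarrow> 1 \<le> T c \<and> T c \<le> 2 * Suc t \<and> \<not> T c \<le> 2 * t" for c
      unfolding F_def SDT_support[OF T, symmetric] by auto
    then have "c \<in> F (Suc t) - F t \<longleftrightarrow> T c = 2 * Suc t - 1 \<or> T c = 2 * Suc t" for c by auto
    then show ?thesis unfolding domino_of_def by blast
  qed
  have less: "F t <\<^sub>d F (Suc t)" if "t < n" for t
  proof -
    have dom: "is_domino (domino_of T (Suc t))" using T'(4)[of "Suc t"] that by simp
    then have "domino_of T (Suc t) \<noteq> {}"
      by (auto simp: is_domino_def horizontal_domino_def vertical_domino_def)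
    moreover have "F t \<subseteq> F (Suc t)" by (auto simp: F_def)
    ultimately have "F t \<subset> F (Suc t)" using diff[of t] by blast
    then show ?thesis using F dom diff by (simp add: less_d_def)
  qed
  have ends: "F 0 = mu" "F n = l"
    using SDT_support[OF T] bij_betwE[OF T'(1)] part(3) unfolding F_def by force+
  \<comment> \<open>A trivial step repeats the current shape: the label, and with it
    \<open>F\<close>, advances only outside \<open>Z\<close>.\<close>
  have "domino_multichain mu l N Z T (\<lambda>k. F (card ({1..k} - Z)))"
    unfolding domino_multichain_Suc
  proof (intro conjI allI impI)
    fix k assume k: "k < N"
    let ?t = "card ({1..k} - Z)"
    have lt: "F ?t <\<^sub>d F (Suc ?t)" if "Suc k \<notin> Z"
    proof (rule less)
      have "card ({1..Suc k} - Z) \<le> n" unfolding n_def using k by (intro card_mono) auto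
      then show "?t < n" using that unfolding card_steps_Suc by simp
    qed
    show "F ?t \<le>\<^sub>d F (card ({1..Suc k} - Z))"
      using lt unfolding card_steps_Suc by (auto simp: le_d_def)
    show "F ?t = F (card ({1..Suc k} - Z)) \<longleftrightarrow> Suc k \<in> Z"
      using lt unfolding card_steps_Suc by (metis less_d_irrefl)
    show "F (card ({1..Suc k} - Z)) - F ?t = domino_of T (Suc ?t)" if "Suc k \<notin> Z"
      using that diff unfolding card_steps_Suc by simp
  qed (use ends n_def in simp_all)
  then show ?thesis by blast
qed

section \<open>From multichains to tableaux\<close>

text \<open>An ordering of the two cells that serves both orientations; it fixes which of them
  carries the odd entry.\<close>

lemma domino_cells:
  assumes "is_domino D"
  obtains a b where "D = {a, b}" "a \<noteq> b" "fst a \<le> fst b" "snd a \<le> snd b"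
proof -
  from assms consider i j where "D = {(i, j), (i, j + 1)}" | i j where "D = {(i, j), (i + 1, j)}"
    by (auto simp: is_domino_def horizontal_domino_def vertical_domino_def)
  then show thesis by cases (rule that, assumption, simp_all)+
qed

text \<open>Monotonicity and injectivity leave one way to place the two entries on a domino, so a
  tableau is determined by its labelled dominoes.\<close>

lemma SDT_domino_entries:
  assumes T: "T \<in> SDT l mu" and size: "skew_of_size l mu (2 * n)" and k: "k \<in> {1..n}"
    and ab: "domino_of T k = {a, b}" "a \<noteq> b" "fst a \<le> fst b" "snd a \<le> snd b"
  shows "T a = 2 * k - 1 \<and> T b = 2 * k"
proof -
  have val: "T a = 2 * k - 1 \<or> T a = 2 * k" "T b = 2 * k - 1 \<or> T b = 2 * k"
    using ab(1) by (auto simp: domino_of_def)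
  then have mem: "a \<in> l - mu" "b \<in> l - mu" using SDT_support[OF T] k by auto
  have "T a \<noteq> T b"
    using bij_betw_imp_inj_on[OF SDTD(1)[OF T size]] mem ab(2) by (auto dest: inj_onD)
  moreover have "T a \<le> T b" using SDTD(3)[OF T size, of "fst a" "snd a" "fst b" "snd b"] mem ab by simp
  ultimately show ?thesis using val by auto
qed

lemma SDT_eqI:
  assumes T: "T \<in> SDT l mu" and T': "T' \<in> SDT l mu" and size: "skew_of_size l mu (2 * n)"
    and dom: "\<And>k. k \<in> {1..n} \<Longrightarrow> domino_of T k = domino_of T' k"
  shows "T = T'"
proof
  fix c
  show "T c = T' c"
  proof (cases "c \<in> l - mu")
    case True
    then have "T c \<in> {1..2 * n}" using bij_betwE[OF SDTD(1)[OF T size]] by blast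
    moreover define k where "k = (T c + 1) div 2"
    ultimately have k: "k \<in> {1..n}" "T c = 2 * k - 1 \<or> T c = 2 * k" by auto
    obtain a b where ab: "domino_of T k = {a, b}" "a \<noteq> b" "fst a \<le> fst b" "snd a \<le> snd b"
      using SDTD(4)[OF T size k(1)] domino_cells by metis
    have "c \<in> {a, b}" using k(2) unfolding ab(1)[symmetric] by (simp add: domino_of_def)
    then show ?thesis
      using SDT_domino_entries[OF T size k(1) ab] SDT_domino_entries[OF T' size k(1) _ ab(2-4)]
        ab(1) dom[OF k(1)] by auto
  next
    case False
    then show ?thesis using SDTD(2)[OF T size] SDTD(2)[OF T' size] by simp
  qed
qed

text \<open>The new entries exceed all old ones, and no new cell precedes an old one because
  \<open>l\<close> is closed downwards. This preserves monotonicity.\<close>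

lemma SDT_extend:
  assumes T: "T \<in> SDT l mu" and size: "skew_of_size l mu (2 * t)" and less: "l <\<^sub>d l'"
  obtains T' where "T' \<in> SDT l' mu" "skew_of_size l' mu (2 * Suc t)" "domino_of T' (Suc t) = l' - l"
    "\<And>k. k \<in> {1..t} \<Longrightarrow> domino_of T' k = domino_of T k"
proof -
  have part: "is_partition l" "is_partition mu" "mu \<subseteq> l" "is_partition l'" "l \<subseteq> l'"
    using size less by (auto simp: skew_of_size_def less_d_def)
  obtain a b where ab: "l' - l = {a, b}" "a \<noteq> b" "fst a \<le> fst b" "snd a \<le> snd b"
    using domino_cells[of "l' - l"] less by (metis less_d_def)
  have new: "a \<notin> l" "b \<notin> l" "l' - mu = (l - mu) \<union> {a, b}" using ab(1) part by blast+
  define T' where "T' = T(a := 2 * t + 1, b := 2 * t + 2)"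
  have T'_new: "T' a = 2 * t + 1" "T' b = 2 * t + 2" and T'_old: "\<And>c. c \<noteq> a \<Longrightarrow> c \<noteq> b \<Longrightarrow> T' c = T c"
    using ab(2) by (auto simp: T'_def)
  have T'_l: "T' c = T c" if "c \<in> l" for c using that new T'_old by metis
  note TD = SDTD[OF T size]
  have bound: "T c \<le> 2 * t" for c
    using bij_betwE[OF TD(1)] TD(2)[of c] by (cases "c \<in> l - mu") auto
  have zero: "T a = 0" "T b = 0" using TD(2) new by auto
  have dom_new: "domino_of T' (Suc t) = {a, b}"
  proof -
    have "T' c = 2 * Suc t - 1 \<or> T' c = 2 * Suc t \<longleftrightarrow> c = a \<or> c = b" for c
      using T'_new T'_old[of c] bound[of c] by (cases "c = a"; cases "c = b") auto
    then show ?thesis by (auto simp: domino_of_def)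
  qed
  have dom_old: "domino_of T' k = domino_of T k" if "k \<in> {1..t}" for k
  proof -
    have "T' c = 2 * k - 1 \<or> T' c = 2 * k \<longleftrightarrow> T c = 2 * k - 1 \<or> T c = 2 * k" for c
      using T'_new T'_old[of c] zero that by (cases "c = a"; cases "c = b") auto
    then show ?thesis by (simp add: domino_of_def)
  qed
  have "card (l' - mu) = 2 * Suc t"
  proof -
    have "card ((l - mu) \<union> {a, b}) = card (l - mu) + card {a, b}"
      using new partition_finite[OF part(1)] by (intro card_Un_disjoint) auto
    then show ?thesis using new size ab(2) by (simp add: skew_of_size_def)
  qed
  then have size': "skew_of_size l' mu (2 * Suc t)" using part by (auto simp: skew_of_size_def)
  have "T' \<in> SDT l' mu"
  proof (rule SDTI[OF size'])
    have "bij_betw T' (l - mu) {1..2 * t}"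
      using TD(1) T'_l by (subst bij_betw_cong[of _ _ T]) auto
    moreover have "bij_betw T' {a, b} {2 * t + 1, 2 * t + 2}"
      using T'_new ab(2) by (auto simp: bij_betw_def)
    ultimately have "bij_betw T' ((l - mu) \<union> {a, b}) ({1..2 * t} \<union> {2 * t + 1, 2 * t + 2})"
      by (rule bij_betw_combine) auto
    moreover have "{1..2 * t} \<union> {2 * t + 1, 2 * t + 2} = {1..2 * Suc t}" by auto
    ultimately show "bij_betw T' (l' - mu) {1..2 * Suc t}" using new(3) by simp
    show "T' c = 0" if "c \<notin> l' - mu" for c
      using that TD(2)[of c] T'_old[of c] new(3) by auto
    show "is_domino (domino_of T' k)" if "k \<in> {1..Suc t}" for k
    proof (cases "k = Suc t")
      case True
      then show ?thesis using dom_new ab(1) less by (simp add: less_d_def)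
    next
      case False
      then show ?thesis using dom_old[of k] TD(4)[of k] that by simp
    qed
    fix i j i' j' assume c: "(i, j) \<in> l' - mu" "(i', j') \<in> l' - mu" "i \<le> i'" "j \<le> j'"
    show "T' (i, j) \<le> T' (i', j')"
    proof (cases "(i', j') \<in> l")
      case True
      then have "(i, j) \<in> l"
        using partition_down[OF part(1) True, of i j] partition_pos[OF part(4), of i j] c by auto
      then show ?thesis using True c T'_l TD(3)[of i j i' j'] by auto
    next
      case False
      then have new': "(i', j') = a \<or> (i', j') = b" using c new(3) by auto
      show ?thesis
      proof (cases "(i, j) \<in> l")
        case True
        then show ?thesis using T'_l[OF True] bound[of "(i, j)"] new' T'_new by auto
      next
        case False
        then have "(i, j) = a \<or> (i, j) = b" using c new(3) by auto
        then show ?thesis using new' T'_new c ab(2-4) by (cases a; cases b) auto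
      qed
    qed
  qed
  then show thesis using that size' dom_new dom_old ab(1) by metis
qed

text \<open>Converse of \<open>SDT_multichain_exists\<close>: each nontrivial step extends the
  tableau by one domino. The size belongs to the induction because it supplies the next
  label.\<close>

lemma multichain_SDT_exists:
  assumes "is_partition (C 0)" "\<forall>k<N. C k \<le>\<^sub>d C (Suc k)" "\<forall>k<N. C k = C (Suc k) \<longleftrightarrow> Suc k \<in> Z"
  shows "\<exists>T \<in> SDT (C N) (C 0). domino_multichain (C 0) (C N) N Z T C \<and>
    skew_of_size (C N) (C 0) (2 * card ({1..N} - Z))"
  using assms(2,3)
proof (induction N)
  case 0
  have "skew_of_size (C 0) (C 0) (2 * 0)" using assms(1) by (simp add: skew_of_size_def)
  moreover from this have "(\<lambda>_. 0) \<in> SDT (C 0) (C 0)"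
    by (rule SDTI) (auto simp: bij_betw_def)
  ultimately show ?case by (auto simp: domino_multichain_def)
next
  case (Suc N)
  then obtain T where T: "T \<in> SDT (C N) (C 0)" "domino_multichain (C 0) (C N) N Z T C"
    "skew_of_size (C N) (C 0) (2 * card ({1..N} - Z))" by auto
  let ?t = "card ({1..N} - Z)"
  show ?case
  proof (cases "Suc N \<in> Z")
    case True
    then have "C (Suc N) = C N" "card ({1..Suc N} - Z) = ?t"
      using Suc.prems unfolding card_steps_Suc by auto
    moreover from this have "domino_multichain (C 0) (C N) (Suc N) Z T C"
      using T(2) Suc.prems True unfolding domino_multichain_Suc by (auto simp: less_Suc_eq)
    ultimately show ?thesis using T by metis
  next
    case False
    then have less: "C N <\<^sub>d C (Suc N)" and card: "card ({1..Suc N} - Z) = Suc ?t"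
      using Suc.prems unfolding card_steps_Suc by (auto simp: le_d_def)
    obtain T' where T': "T' \<in> SDT (C (Suc N)) (C 0)" "skew_of_size (C (Suc N)) (C 0) (2 * Suc ?t)"
      "domino_of T' (Suc ?t) = C (Suc N) - C N" "\<And>k. k \<in> {1..?t} \<Longrightarrow> domino_of T' k = domino_of T k"
      using SDT_extend[OF T(1,3) less] by blast
    have "C (Suc k) - C k = domino_of T' (Suc (card ({1..k} - Z)))" if "k < Suc N" "Suc k \<notin> Z" for k
    proof (cases "k = N")
      case True
      then show ?thesis using T'(3) by simp
    next
      case k: False
      \<comment> \<open>Earlier steps only use labels up to \<open>?t\<close>, on which
        \<open>T'\<close> and \<open>T\<close> have the same dominoes.\<close>
      have "card ({1..Suc k} - Z) \<le> ?t" using that k by (intro card_mono) auto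
      then have "domino_of T' (Suc (card ({1..k} - Z))) = domino_of T (Suc (card ({1..k} - Z)))"
        using that unfolding card_steps_Suc by (intro T'(4)) simp
      then show ?thesis using T(2) that k unfolding domino_multichain_Suc by auto
    qed
    then have "domino_multichain (C 0) (C (Suc N)) (Suc N) Z T' C"
      using Suc.prems unfolding domino_multichain_Suc by blast
    then show ?thesis using T' card by metis
  qed
qed

lemma domino_multichain_SDT_unique:
  assumes "domino_multichain mu l N Z T C" "domino_multichain mu l N Z T' C"
    and "T \<in> SDT l mu" "T' \<in> SDT l mu" "skew_of_size l mu (2 * card ({1..N} - Z))"
  shows "T = T'"
proof (rule SDT_eqI[OF assms(3-5)])
  fix t assume "t \<in> {1..card ({1..N} - Z)}"
  then obtain k where "k \<in> {1..N}" "k \<notin> Z" "card ({1..k} - Z) = t" using card_steps_surj by blast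
  then show "domino_of T t = domino_of T' t" using assms(1,2) by (auto simp: domino_multichain_def)
qed

section \<open>Growth diagrams\<close>

text \<open>The boundary tableaux are left out, so the same notion serves fillings started from
  either pair of borders.\<close>

definition growth_diagram :: "nat \<Rightarrow> nat \<Rightarrow> (nat \<Rightarrow> nat \<Rightarrow> int) \<Rightarrow> (nat \<Rightarrow> nat \<Rightarrow> diagram) \<Rightarrow> bool" where
  "growth_diagram n m M \<Gamma> \<longleftrightarrow>
     (\<forall>i\<le>n. \<forall>k\<le>m. is_partition (\<Gamma> i k)) \<and>
     (\<forall>i\<le>n. \<forall>k<m. \<Gamma> i k \<le>\<^sub>d \<Gamma> i (Suc k)) \<and>
     (\<forall>i<n. \<forall>k\<le>m. \<Gamma> i k \<le>\<^sub>d \<Gamma> (Suc i) k) \<and>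
     (\<forall>i<n. \<forall>k<m. local_rule (M (Suc i) (Suc k)) (\<Gamma> i k) (\<Gamma> i (Suc k)) (\<Gamma> (Suc i) k) (\<Gamma> (Suc i) (Suc k)))"

lemma growth_diagramD:
  assumes "growth_diagram n m M \<Gamma>"
  shows "i \<le> n \<Longrightarrow> k \<le> m \<Longrightarrow> is_partition (\<Gamma> i k)"
    and "i \<le> n \<Longrightarrow> k < m \<Longrightarrow> \<Gamma> i k \<le>\<^sub>d \<Gamma> i (Suc k)"
    and "i < n \<Longrightarrow> k \<le> m \<Longrightarrow> \<Gamma> i k \<le>\<^sub>d \<Gamma> (Suc i) k"
    and "i < n \<Longrightarrow> k < m \<Longrightarrow>
      local_rule (M (Suc i) (Suc k)) (\<Gamma> i k) (\<Gamma> i (Suc k)) (\<Gamma> (Suc i) k) (\<Gamma> (Suc i) (Suc k))"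
  using assms by (auto simp: growth_diagram_def)

text \<open>One recursion over the rows, with a recursion along each row inside it. The function
  \<open>f\<close> sees the indices because the rule at a square depends on its matrix
  entry.\<close>

lemma grid_recursion:
  fixes f :: "nat \<Rightarrow> nat \<Rightarrow> 'a \<Rightarrow> 'a \<Rightarrow> 'a \<Rightarrow> 'a"
  assumes "first_row 0 = first_column 0"
  obtains H where "\<And>k. H 0 k = first_row k" "\<And>i. H i 0 = first_column i"
    "\<And>i k. H (Suc i) (Suc k) = f i k (H i k) (H i (Suc k)) (H (Suc i) k)"
proof -
  define H where "H = rec_nat first_row (\<lambda>i R. rec_nat (first_column (Suc i)) (\<lambda>k. f i k (R k) (R (Suc k))))"
  have "H i 0 = first_column i" for i by (cases i) (simp_all add: H_def assms)
  then show thesis by (intro that[of H]) (simp_all add: H_def)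
qed

lemma local_rule_functional:
  assumes "is_partition \<nu>" "\<nu> \<le>\<^sub>d \<kappa>" "\<nu> \<le>\<^sub>d \<rho>" "local_rule x \<nu> \<kappa> \<rho> \<tau>" "local_rule x \<nu> \<kappa> \<rho> \<tau>'"
  shows "\<tau> = \<tau>'"
proof -
  have "x \<in> {1, -1, 0}" "x \<noteq> 0 \<Longrightarrow> \<nu> = \<kappa> \<and> \<nu> = \<rho>" using local_rule_entry[OF assms(4)] by auto
  then show ?thesis using local_rule_forward[OF assms(1-3)] assms(4,5) by metis
qed

lemma PPMD:
  assumes "M \<in> PPM n m j"
  shows "M i k \<in> {1, -1, 0}" "M i k \<noteq> 0 \<Longrightarrow> i \<in> {1..n} \<and> k \<in> {1..m}"
    "M i k \<noteq> 0 \<Longrightarrow> M i k' \<noteq> 0 \<Longrightarrow> k = k'" "M i k \<noteq> 0 \<Longrightarrow> M i' k \<noteq> 0 \<Longrightarrow> i = i'"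
    "card {(i, k). M i k \<noteq> 0} = j"
proof -
  have "(\<forall>i k. M i k \<in> {1, -1, 0}) \<and> (\<forall>i k. \<not> (i \<in> {1..n} \<and> k \<in> {1..m}) \<longrightarrow> M i k = 0) \<and>
     (\<forall>i k k'. M i k \<noteq> 0 \<and> M i k' \<noteq> 0 \<longrightarrow> k = k') \<and>
     (\<forall>i i' k. M i k \<noteq> 0 \<and> M i' k \<noteq> 0 \<longrightarrow> i = i') \<and>
     card {(i, k). M i k \<noteq> 0} = j"
    using assms unfolding PPM_def by (rule CollectD)
  then show "M i k \<in> {1, -1, 0}" "M i k \<noteq> 0 \<Longrightarrow> i \<in> {1..n} \<and> k \<in> {1..m}"
    "M i k \<noteq> 0 \<Longrightarrow> M i k' \<noteq> 0 \<Longrightarrow> k = k'" "M i k \<noteq> 0 \<Longrightarrow> M i' k \<noteq> 0 \<Longrightarrow> i = i'"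
    "card {(i, k). M i k \<noteq> 0} = j"
    by metis+
qed

text \<open>Both projections are injective on the \<open>j\<close> nonzero positions. This matches
  the domino counts \<open>m - j\<close> and \<open>n - j\<close> of \<open>U\<close> and
  \<open>V\<close> with the nontrivial steps on the borders.\<close>

lemma PPM_card_trivial_steps:
  assumes "M \<in> PPM n m j"
  shows "card ({1..m} - {k. \<exists>i. M i k \<noteq> 0}) = m - j" "card ({1..n} - {i. \<exists>k. M i k \<noteq> 0}) = n - j"
proof -
  let ?S = "{(i, k). M i k \<noteq> 0}"
  have "snd ` ?S = {k. \<exists>i. M i k \<noteq> 0}" "inj_on snd ?S"
    using PPMD(4)[OF assms] by (force simp: inj_on_def)+
  then have k: "card {k. \<exists>i. M i k \<noteq> 0} = j" using PPMD(5)[OF assms] card_image by metis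
  have sub: "{k. \<exists>i. M i k \<noteq> 0} \<subseteq> {1..m}" using PPMD(2)[OF assms] by blast
  show "card ({1..m} - {k. \<exists>i. M i k \<noteq> 0}) = m - j"
    using k by (subst card_Diff_subset[OF finite_subset[OF sub] sub]) auto
  have "fst ` ?S = {i. \<exists>k. M i k \<noteq> 0}" "inj_on fst ?S"
    using PPMD(3)[OF assms] by (force simp: inj_on_def)+
  then have i: "card {i. \<exists>k. M i k \<noteq> 0} = j" using PPMD(5)[OF assms] card_image by metis
  have sub: "{i. \<exists>k. M i k \<noteq> 0} \<subseteq> {1..n}" using PPMD(2)[OF assms] by blast
  show "card ({1..n} - {i. \<exists>k. M i k \<noteq> 0}) = n - j"
    using i by (subst card_Diff_subset[OF finite_subset[OF sub] sub]) auto
qed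

section \<open>Filling from the top left\<close>

text \<open>The last hypothesis is conditional so that it covers both a given array and one filled
  by \<open>SOME\<close>, where solvability of the rule is part of what must be shown. The invariant
  says that a step is trivial as long as its nonzero entry is still ahead; at that entry both steps
  are hence trivial, as rules (1) and (2) require.\<close>

lemma growth_invariant:
  assumes M: "M \<in> PPM n m j" and corner: "is_partition (\<Gamma> 0 0)"
    and top: "\<And>k. k < m \<Longrightarrow> \<Gamma> 0 k \<le>\<^sub>d \<Gamma> 0 (Suc k) \<and> (\<Gamma> 0 k = \<Gamma> 0 (Suc k) \<longleftrightarrow> (\<exists>i. M i (Suc k) \<noteq> 0))"
    and left: "\<And>i. i < n \<Longrightarrow> \<Gamma> i 0 \<le>\<^sub>d \<Gamma> (Suc i) 0 \<and> (\<Gamma> i 0 = \<Gamma> (Suc i) 0 \<longleftrightarrow> (\<exists>k. M (Suc i) k \<noteq> 0))"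
    and rule: "\<And>i k \<tau>. i < n \<Longrightarrow> k < m \<Longrightarrow>
      local_rule (M (Suc i) (Suc k)) (\<Gamma> i k) (\<Gamma> i (Suc k)) (\<Gamma> (Suc i) k) \<tau> \<Longrightarrow>
      local_rule (M (Suc i) (Suc k)) (\<Gamma> i k) (\<Gamma> i (Suc k)) (\<Gamma> (Suc i) k) (\<Gamma> (Suc i) (Suc k))"
  shows "growth_diagram n m M \<Gamma>"
    and "i \<le> n \<Longrightarrow> k < m \<Longrightarrow> \<Gamma> i k = \<Gamma> i (Suc k) \<longleftrightarrow> (\<exists>i'>i. M i' (Suc k) \<noteq> 0)"
    and "i < n \<Longrightarrow> k \<le> m \<Longrightarrow> \<Gamma> i k = \<Gamma> (Suc i) k \<longleftrightarrow> (\<exists>k'>k. M (Suc i) k' \<noteq> 0)"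
proof -
  define row where "row i k \<longleftrightarrow> is_partition (\<Gamma> i k) \<and> \<Gamma> i k \<le>\<^sub>d \<Gamma> i (Suc k) \<and>
    (\<Gamma> i k = \<Gamma> i (Suc k) \<longleftrightarrow> (\<exists>i'>i. M i' (Suc k) \<noteq> 0))" for i k
  define col where "col i k \<longleftrightarrow> is_partition (\<Gamma> i k) \<and> \<Gamma> i k \<le>\<^sub>d \<Gamma> (Suc i) k \<and>
    (\<Gamma> i k = \<Gamma> (Suc i) k \<longleftrightarrow> (\<exists>k'>k. M (Suc i) k' \<noteq> 0))" for i k
  \<comment> \<open>Row and column 0 of \<open>M\<close> vanish, so on the borders an entry anywhere
    in a line is the same as an entry at a positive index.\<close>
  have zero: "M 0 k = 0" "M i 0 = 0" for i k using PPMD(2)[OF M, of 0 k] PPMD(2)[OF M, of i 0] by auto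
  have le_partition: "is_partition l" if "is_partition k" "k \<le>\<^sub>d l" for k l
    using that by (auto simp: le_d_def less_d_def)
  have cell: "local_rule (M (Suc i) (Suc k)) (\<Gamma> i k) (\<Gamma> i (Suc k)) (\<Gamma> (Suc i) k) (\<Gamma> (Suc i) (Suc k)) \<and>
    row (Suc i) k \<and> col i (Suc k)" if "i < n" "k < m" "row i k" "col i k" for i k
  proof -
    let ?x = "M (Suc i) (Suc k)"
    have h: "is_partition (\<Gamma> i k)" "\<Gamma> i k \<le>\<^sub>d \<Gamma> i (Suc k)" "\<Gamma> i k \<le>\<^sub>d \<Gamma> (Suc i) k"
      using that by (auto simp: row_def col_def)
    have eq: "\<Gamma> i k = \<Gamma> i (Suc k) \<longleftrightarrow> (\<exists>i'>i. M i' (Suc k) \<noteq> 0)"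
      "\<Gamma> i k = \<Gamma> (Suc i) k \<longleftrightarrow> (\<exists>k'>k. M (Suc i) k' \<noteq> 0)"
      using that by (auto simp: row_def col_def)
    have "?x \<noteq> 0 \<Longrightarrow> \<Gamma> i k = \<Gamma> i (Suc k) \<and> \<Gamma> i k = \<Gamma> (Suc i) k" unfolding eq by blast
    then obtain \<tau> where "local_rule ?x (\<Gamma> i k) (\<Gamma> i (Suc k)) (\<Gamma> (Suc i) k) \<tau>"
      using local_rule_forward[OF h PPMD(1)[OF M]] by metis
    then have r: "local_rule ?x (\<Gamma> i k) (\<Gamma> i (Suc k)) (\<Gamma> (Suc i) k) (\<Gamma> (Suc i) (Suc k))"
      using rule that(1,2) by blast
    note e = local_rule_edges[OF h r]
    \<comment> \<open>Each column has at most one nonzero entry: one further down forces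
      \<open>?x = 0\<close>, and if \<open>?x = 0\<close>, one below row \<open>i\<close> is below
      row \<open>Suc i\<close>.\<close>
    have "(\<exists>i'>i. M i' (Suc k) \<noteq> 0) \<and> ?x = 0 \<longleftrightarrow> (\<exists>i'>Suc i. M i' (Suc k) \<noteq> 0)"
      using PPMD(4)[OF M] by (metis Suc_lessD Suc_lessI less_irrefl)
    moreover have "(\<exists>k'>k. M (Suc i) k' \<noteq> 0) \<and> ?x = 0 \<longleftrightarrow> (\<exists>k'>Suc k. M (Suc i) k' \<noteq> 0)"
      using PPMD(3)[OF M] by (metis Suc_lessD Suc_lessI less_irrefl)
    ultimately show ?thesis
      using r e eq le_partition[OF h(1) h(2)] le_partition[OF h(1) h(3)] unfolding row_def col_def by blast
  qed
  have row_i: "\<forall>k<m. row i k" if "i \<le> n" for i using that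
  proof (induction i)
    case 0
    have "is_partition (\<Gamma> 0 k)" if "k \<le> m" for k
      using multichain_partition[of "\<Gamma> 0" m k] corner top that by blast
    then show ?case using top zero unfolding row_def by (metis gr0I less_imp_le)
  next
    case (Suc i)
    \<comment> \<open>The vertical steps out of row \<open>i\<close> are found from left to right,
      using the horizontal steps of that row; only then is row \<open>Suc i\<close>
      available.\<close>
    have "k \<le> m \<Longrightarrow> col i k" for k
    proof (induction k)
      case 0
      have "is_partition (\<Gamma> i 0)"
        using multichain_partition[of "\<lambda>i. \<Gamma> i 0" n i] corner left Suc.prems by simp
      then show ?case using left[of i] zero Suc.prems unfolding col_def by (metis Suc_le_eq gr0I)
    next
      case (Suc k)
      then show ?case using cell[of i k] Suc.IH \<open>Suc i \<le> n\<close> \<open>i \<le> n \<Longrightarrow> \<forall>k<m. row i k\<close> by auto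
    qed
    then show ?case using cell[of i] Suc by auto
  qed
  have col_k: "col i k" if "i < n" "k \<le> m" for i k using that(2)
  proof (induction k)
    case 0
    have "is_partition (\<Gamma> i 0)"
      using multichain_partition[of "\<lambda>i. \<Gamma> i 0" n i] corner left that by simp
    then show ?case using left[of i] zero that unfolding col_def by (metis gr0I)
  next
    case (Suc k)
    then show ?case using cell[of i k] row_i[of i] that by auto
  qed
  have part_left: "is_partition (\<Gamma> i 0)" if "i \<le> n" for i
    using multichain_partition[of "\<lambda>i. \<Gamma> i 0" n i] corner left that by simp
  have part: "is_partition (\<Gamma> i k)" if "i \<le> n" "k \<le> m" for i k
    using multichain_partition[of "\<Gamma> i" m k] part_left[OF that(1)] row_i[OF that(1)] that(2)
    by (auto simp: row_def)
  show "growth_diagram n m M \<Gamma>"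
    unfolding growth_diagram_def using part row_i col_k cell by (auto simp: row_def col_def)
  show "i \<le> n \<Longrightarrow> k < m \<Longrightarrow> \<Gamma> i k = \<Gamma> i (Suc k) \<longleftrightarrow> (\<exists>i'>i. M i' (Suc k) \<noteq> 0)"
    using row_i by (auto simp: row_def)
  show "i < n \<Longrightarrow> k \<le> m \<Longrightarrow> \<Gamma> i k = \<Gamma> (Suc i) k \<longleftrightarrow> (\<exists>k'>k. M (Suc i) k' \<noteq> 0)"
    using col_k by (auto simp: col_def)
qed

lemma growth_diagram_forward_unique:
  assumes g: "growth_diagram n m M \<Gamma>" "growth_diagram n m M \<Gamma>'"
    and top: "\<And>k. k \<le> m \<Longrightarrow> \<Gamma> 0 k = \<Gamma>' 0 k" and left: "\<And>i. i \<le> n \<Longrightarrow> \<Gamma> i 0 = \<Gamma>' i 0"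
  shows "i \<le> n \<Longrightarrow> k \<le> m \<Longrightarrow> \<Gamma> i k = \<Gamma>' i k"
proof (induction i arbitrary: k)
  case 0
  then show ?case using top by simp
next
  case (Suc i)
  note IH = Suc.IH and i = Suc.prems(1)
  from Suc.prems(2) show ?case
  proof (induction k)
    case 0
    then show ?case using left i by simp
  next
    case (Suc k)
    have "\<Gamma> i k = \<Gamma>' i k" "\<Gamma> i (Suc k) = \<Gamma>' i (Suc k)" "\<Gamma> (Suc i) k = \<Gamma>' (Suc i) k"
      using IH[of k] IH[of "Suc k"] Suc i by auto
    then show ?case
      using local_rule_functional[OF growth_diagramD(1)[OF g(1), of i k] growth_diagramD(2)[OF g(1), of i k]
          growth_diagramD(3)[OF g(1), of i k] growth_diagramD(4)[OF g(1), of i k]]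
        growth_diagramD(4)[OF g(2), of i k] Suc.prems i by simp
  qed
qed

section \<open>Filling from the bottom right\<close>

text \<open>Inverting the squares upwards and to the left returns the matrix entries together with
  the corners, so the two matrices may differ a priori.\<close>

lemma growth_diagram_backward_unique:
  assumes g: "growth_diagram n m M \<Gamma>" "growth_diagram n m M' \<Gamma>'"
    and bottom: "\<And>k. k \<le> m \<Longrightarrow> \<Gamma> n k = \<Gamma>' n k" and right: "\<And>i. i \<le> n \<Longrightarrow> \<Gamma> i m = \<Gamma>' i m"
  shows "i \<le> n \<Longrightarrow> k \<le> m \<Longrightarrow> \<Gamma> i k = \<Gamma>' i k"
    and "i < n \<Longrightarrow> k < m \<Longrightarrow> M (Suc i) (Suc k) = M' (Suc i) (Suc k)"
proof -
  have cell: "M (Suc i) (Suc k) = M' (Suc i) (Suc k) \<and> \<Gamma> i k = \<Gamma>' i k"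
    if "i < n" "k < m" "\<Gamma> i (Suc k) = \<Gamma>' i (Suc k)" "\<Gamma> (Suc i) k = \<Gamma>' (Suc i) k"
      "\<Gamma> (Suc i) (Suc k) = \<Gamma>' (Suc i) (Suc k)" for i k
    using local_rule_backward_unique[of "\<Gamma> i k" "\<Gamma> i (Suc k)" "\<Gamma> (Suc i) k" "M (Suc i) (Suc k)"
        "\<Gamma> (Suc i) (Suc k)" "\<Gamma>' i k" "M' (Suc i) (Suc k)"]
      growth_diagramD[OF g(1), of i k] growth_diagramD[OF g(2), of i k] that by simp
  have eq: "\<forall>k\<le>m. \<Gamma> i k = \<Gamma>' i k" if "i \<le> n" for i using that
  proof (induction rule: inc_induct)
    case base
    then show ?case using bottom by blast
  next
    case (step i)
    have "\<Gamma> i k = \<Gamma>' i k" if "k \<le> m" for k using that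
    proof (induction rule: inc_induct)
      case base
      then show ?case using right step by simp
    next
      case (step k)
      then show ?case using cell[of i k] \<open>i < n\<close> \<open>\<forall>k\<le>m. \<Gamma> (Suc i) k = \<Gamma>' (Suc i) k\<close> by simp
    qed
    then show ?case by blast
  qed
  show "i \<le> n \<Longrightarrow> k \<le> m \<Longrightarrow> \<Gamma> i k = \<Gamma>' i k" using eq by blast
  show "i < n \<Longrightarrow> k < m \<Longrightarrow> M (Suc i) (Suc k) = M' (Suc i) (Suc k)" using cell[of i k] eq by simp
qed

lemma growth_diagram_backward_exists:
  assumes B: "is_partition (B m)" "\<And>k. k < m \<Longrightarrow> B k \<le>\<^sub>d B (Suc k)"
    and R: "\<And>i. i < n \<Longrightarrow> R i \<le>\<^sub>d R (Suc i)" and corner: "B m = R n"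
  obtains M \<Gamma> where "growth_diagram n m M \<Gamma>" "\<And>k. k \<le> m \<Longrightarrow> \<Gamma> n k = B k" "\<And>i. i \<le> n \<Longrightarrow> \<Gamma> i m = R i"
    "\<And>i k. \<not> (i \<in> {1..n} \<and> k \<in> {1..m}) \<Longrightarrow> M i k = 0"
    "\<And>i k. \<not> (i \<le> n \<and> k \<le> m) \<Longrightarrow> \<Gamma> i k = {}"
proof -
  \<comment> \<open>Only the corner is needed to continue the recursion; the entry is chosen once
    the array is complete.\<close>
  define f where "f = (\<lambda>\<tau> \<rho> \<kappa>. SOME \<nu>. \<nu> \<le>\<^sub>d \<kappa> \<and> \<nu> \<le>\<^sub>d \<rho> \<and> (\<exists>x. local_rule x \<nu> \<kappa> \<rho> \<tau>))"
  have f: "f \<tau> \<rho> \<kappa> \<le>\<^sub>d \<kappa> \<and> f \<tau> \<rho> \<kappa> \<le>\<^sub>d \<rho> \<and> (\<exists>x. local_rule x (f \<tau> \<rho> \<kappa>) \<kappa> \<rho> \<tau>)"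
    if "is_partition \<tau>" "\<kappa> \<le>\<^sub>d \<tau>" "\<rho> \<le>\<^sub>d \<tau>" for \<tau> \<rho> \<kappa>
    unfolding f_def by (rule someI_ex) (metis local_rule_backward[OF that])
  \<comment> \<open>\<open>H a b\<close> stands for the shape \<open>a\<close> rows above and
    \<open>b\<close> columns to the left of the bottom right corner. Thus \<open>H a b\<close>,
    \<open>H a (Suc b)\<close> and \<open>H (Suc a) b\<close> play the parts of \<tau>, \<rho> and
    \<kappa>.\<close>
  obtain H where H: "\<And>b. H 0 b = B (m - b)" "\<And>a. H a 0 = R (n - a)"
    "\<And>a b. H (Suc a) (Suc b) = f (H a b) (H a (Suc b)) (H (Suc a) b)"
    using grid_recursion[of "\<lambda>b. B (m - b)" "\<lambda>a. R (n - a)" "\<lambda>_ _. f"] corner by auto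
  have ge_partition: "is_partition k" if "is_partition l" "k \<le>\<^sub>d l" for k l
    using that by (auto simp: le_d_def less_d_def)
  define row where "row a b \<longleftrightarrow> is_partition (H a b) \<and> H a (Suc b) \<le>\<^sub>d H a b" for a b
  define col where "col a b \<longleftrightarrow> is_partition (H a b) \<and> H (Suc a) b \<le>\<^sub>d H a b" for a b
  have cell: "row (Suc a) b \<and> col a (Suc b) \<and>
      (\<exists>x. local_rule x (H (Suc a) (Suc b)) (H (Suc a) b) (H a (Suc b)) (H a b))"
    if "row a b" "col a b" for a b
    using f[of "H a b" "H (Suc a) b" "H a (Suc b)"] that ge_partition unfolding H(3) row_def col_def by metis
  have row_0: "row 0 b" if "b < m" for b
  proof -
    have "H 0 (Suc b) \<le>\<^sub>d H 0 b" if "b < m" for b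
      using B(2)[of "m - Suc b"] that unfolding H(1) by (simp add: Suc_diff_Suc)
    moreover from this have "is_partition (H 0 b)" if "b \<le> m" for b
      using that by (induction b) (use B(1) ge_partition H(1) in \<open>auto simp: Suc_le_eq\<close>)
    ultimately show ?thesis using that by (simp add: row_def)
  qed
  have col_0: "col a 0" if "a < n" for a
  proof -
    have "H (Suc a) 0 \<le>\<^sub>d H a 0" if "a < n" for a
      using R[of "n - Suc a"] that unfolding H(2) by (simp add: Suc_diff_Suc)
    moreover from this have "is_partition (H a 0)" if "a \<le> n" for a
      using that by (induction a) (use B(1) ge_partition H(1) in \<open>auto simp: Suc_le_eq\<close>)
    ultimately show ?thesis using that by (simp add: col_def)
  qed
  have row_a: "\<forall>b<m. row a b" if "a \<le> n" for a using that
  proof (induction a)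
    case (Suc a)
    have "b \<le> m \<Longrightarrow> col a b" for b
      by (induction b) (use Suc col_0 cell in \<open>auto simp: Suc_le_eq\<close>)
    then show ?case using Suc cell by (auto simp: Suc_le_eq)
  qed (use row_0 in blast)
  have col_b: "col a b" if "a < n" "b \<le> m" for a b
    using that(2) by (induction b) (use that(1) row_a[of a] col_0 cell in \<open>auto simp: Suc_le_eq\<close>)
  have part_0: "is_partition (H a 0)" if "a \<le> n" for a
  proof (cases a)
    case 0
    then show ?thesis using B(1) H(1) by simp
  next
    case (Suc a')
    then show ?thesis using col_0[of a'] that ge_partition by (auto simp: col_def)
  qed
  have part: "is_partition (H a b)" if "a \<le> n" "b \<le> m" for a b
  proof (cases b)
    case 0
    then show ?thesis using part_0 that by simp
  next
    case (Suc b')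
    then have "row a b'" using row_a that by auto
    then show ?thesis using Suc ge_partition by (auto simp: row_def)
  qed
  define \<Gamma> where "\<Gamma> i k = (if i \<le> n \<and> k \<le> m then H (n - i) (m - k) else {})" for i k
  define M where "M i k = (if i \<in> {1..n} \<and> k \<in> {1..m} then
      SOME x. local_rule x (\<Gamma> (i - 1) (k - 1)) (\<Gamma> (i - 1) k) (\<Gamma> i (k - 1)) (\<Gamma> i k) else 0)" for i k
  have "growth_diagram n m M \<Gamma>"
    unfolding growth_diagram_def
  proof (intro conjI allI impI)
    show "is_partition (\<Gamma> i k)" if "i \<le> n" "k \<le> m" for i k
      using part that by (simp add: \<Gamma>_def)
    show "\<Gamma> i k \<le>\<^sub>d \<Gamma> i (Suc k)" if "i \<le> n" "k < m" for i k
    proof -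
      have "m - k = Suc (m - Suc k)" using that by simp
      then show ?thesis using row_a[of "n - i"] that by (simp add: \<Gamma>_def row_def)
    qed
    show "\<Gamma> i k \<le>\<^sub>d \<Gamma> (Suc i) k" if "i < n" "k \<le> m" for i k
    proof -
      have "n - i = Suc (n - Suc i)" using that by simp
      then show ?thesis using col_b[of "n - Suc i" "m - k"] that by (simp add: \<Gamma>_def col_def)
    qed
    show "local_rule (M (Suc i) (Suc k)) (\<Gamma> i k) (\<Gamma> i (Suc k)) (\<Gamma> (Suc i) k) (\<Gamma> (Suc i) (Suc k))"
      if "i < n" "k < m" for i k
    proof -
      have "n - i = Suc (n - Suc i)" "m - k = Suc (m - Suc k)" using that by simp_all
      then have "\<exists>x. local_rule x (\<Gamma> i k) (\<Gamma> i (Suc k)) (\<Gamma> (Suc i) k) (\<Gamma> (Suc i) (Suc k))"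
        using cell[of "n - Suc i" "m - Suc k"] row_a[of "n - Suc i"] col_b[of "n - Suc i" "m - Suc k"] that
        by (simp add: \<Gamma>_def)
      from someI_ex[OF this] show ?thesis using that by (simp add: M_def)
    qed
  qed
  moreover have "\<Gamma> n k = B k" if "k \<le> m" for k using that by (simp add: \<Gamma>_def H)
  moreover have "\<Gamma> i m = R i" if "i \<le> n" for i using that by (simp add: \<Gamma>_def H)
  ultimately show thesis by (rule that) (auto simp: \<Gamma>_def M_def)
qed

text \<open>For one column, \<open>c i\<close> says that its step in row \<open>i\<close> is trivial
  and \<open>y i\<close> that its entry in row \<open>i\<close> is nonzero. Going down,
  \<open>c\<close> changes only from true to false, exactly at a nonzero entry, and such an entry
  needs \<open>c\<close> just before it. Hence there is at most one, and as \<open>c n\<close> is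
  false, \<open>c i\<close> holds iff it lies below row \<open>i\<close>.\<close>

lemma single_switch:
  fixes c y :: "nat \<Rightarrow> bool"
  assumes step: "\<And>i. i < n \<Longrightarrow> c (Suc i) \<longleftrightarrow> c i \<and> \<not> y (Suc i)" "\<And>i. i < n \<Longrightarrow> y (Suc i) \<Longrightarrow> c i"
    and last: "\<not> c n" and supp: "\<And>i. y i \<Longrightarrow> i \<in> {1..n}"
  shows "i \<le> n \<Longrightarrow> c i \<longleftrightarrow> (\<exists>i'>i. y i')" "y i \<Longrightarrow> y i' \<Longrightarrow> i = i'"
proof -
  have c: "c i \<longleftrightarrow> (\<exists>i'>i. y i')" if "i \<le> n" for i using that
  proof (induction rule: inc_induct)
    case base
    then show ?case using last supp by fastforce
  next
    case (step i)
    then show ?case using assms(1,2)[of i] by (metis Suc_lessD Suc_lessI lessI)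
  qed
  then show "i \<le> n \<Longrightarrow> c i \<longleftrightarrow> (\<exists>i'>i. y i')" .
  have "\<not> y i'" if "y i" "i < i'" for i i'
  proof
    assume "y i'"
    have i: "i \<in> {1..n}" using supp that(1) .
    then have "\<not> c i" using assms(1)[of "i - 1"] that by (cases i) auto
    then show False using c[of i] i \<open>y i'\<close> that(2) by auto
  qed
  then show "y i \<Longrightarrow> y i' \<Longrightarrow> i = i'" by (metis linorder_neqE_nat)
qed

text \<open>\<open>single_switch\<close> is applied to every column and every row; strictness of the
  bottom and right borders is its condition at the end of each line.\<close>

lemma growth_diagram_strict_PPM:
  assumes g: "growth_diagram n m M \<Gamma>"
    and supp: "\<And>i k. \<not> (i \<in> {1..n} \<and> k \<in> {1..m}) \<Longrightarrow> M i k = 0"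
    and bottom: "\<And>k. k < m \<Longrightarrow> \<Gamma> n k \<noteq> \<Gamma> n (Suc k)" and right: "\<And>i. i < n \<Longrightarrow> \<Gamma> i m \<noteq> \<Gamma> (Suc i) m"
  shows "M \<in> PPM n m (card {(i, k). M i k \<noteq> 0})"
    and "k < m \<Longrightarrow> \<Gamma> 0 k = \<Gamma> 0 (Suc k) \<longleftrightarrow> (\<exists>i. M i (Suc k) \<noteq> 0)"
    and "i < n \<Longrightarrow> \<Gamma> i 0 = \<Gamma> (Suc i) 0 \<longleftrightarrow> (\<exists>k. M (Suc i) k \<noteq> 0)"
proof -
  note D = growth_diagramD[OF g]
  have edges: "\<Gamma> i (Suc k) = \<Gamma> (Suc i) (Suc k) \<longleftrightarrow> \<Gamma> i k = \<Gamma> (Suc i) k \<and> M (Suc i) (Suc k) = 0"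
    "\<Gamma> (Suc i) k = \<Gamma> (Suc i) (Suc k) \<longleftrightarrow> \<Gamma> i k = \<Gamma> i (Suc k) \<and> M (Suc i) (Suc k) = 0"
    "M (Suc i) (Suc k) \<noteq> 0 \<Longrightarrow> \<Gamma> i k = \<Gamma> i (Suc k) \<and> \<Gamma> i k = \<Gamma> (Suc i) k"
    if "i < n" "k < m" for i k
    using local_rule_edges(3,4)[OF D(1)[of i k] D(2)[of i k] D(3)[of i k] D(4)[of i k]]
      local_rule_entry[OF D(4)[of i k]] that by auto
  have cols: "(i \<le> n \<longrightarrow> (\<Gamma> i k = \<Gamma> i (Suc k) \<longleftrightarrow> (\<exists>i'>i. M i' (Suc k) \<noteq> 0))) \<and>
    (M i (Suc k) \<noteq> 0 \<longrightarrow> M i' (Suc k) \<noteq> 0 \<longrightarrow> i = i')" if "k < m" for i i' k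
  proof -
    note s = single_switch[of n "\<lambda>i. \<Gamma> i k = \<Gamma> i (Suc k)" "\<lambda>i. M i (Suc k) \<noteq> 0"]
    have 1: "\<Gamma> (Suc i) k = \<Gamma> (Suc i) (Suc k) \<longleftrightarrow> \<Gamma> i k = \<Gamma> i (Suc k) \<and> \<not> M (Suc i) (Suc k) \<noteq> 0"
      "M (Suc i) (Suc k) \<noteq> 0 \<Longrightarrow> \<Gamma> i k = \<Gamma> i (Suc k)" if "i < n" for i
      using edges[OF that \<open>k < m\<close>] by auto
    have 2: "i \<in> {1..n}" if "M i (Suc k) \<noteq> 0" for i using supp that by blast
    show ?thesis using s(1)[OF 1 bottom[OF that] 2, of i] s(2)[OF 1 bottom[OF that] 2, of i i'] by blast
  qed
  have rows: "(k \<le> m \<longrightarrow> (\<Gamma> i k = \<Gamma> (Suc i) k \<longleftrightarrow> (\<exists>k'>k. M (Suc i) k' \<noteq> 0))) \<and>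
    (M (Suc i) k \<noteq> 0 \<longrightarrow> M (Suc i) k' \<noteq> 0 \<longrightarrow> k = k')" if "i < n" for i k k'
  proof -
    note s = single_switch[of m "\<lambda>k. \<Gamma> i k = \<Gamma> (Suc i) k" "\<lambda>k. M (Suc i) k \<noteq> 0"]
    have 1: "\<Gamma> i (Suc k) = \<Gamma> (Suc i) (Suc k) \<longleftrightarrow> \<Gamma> i k = \<Gamma> (Suc i) k \<and> \<not> M (Suc i) (Suc k) \<noteq> 0"
      "M (Suc i) (Suc k) \<noteq> 0 \<Longrightarrow> \<Gamma> i k = \<Gamma> (Suc i) k" if "k < m" for k
      using edges[OF \<open>i < n\<close> that] by auto
    have 2: "k \<in> {1..m}" if "M (Suc i) k \<noteq> 0" for k using supp that by blast
    show ?thesis using s(1)[OF 1 right[OF that] 2, of k] s(2)[OF 1 right[OF that] 2, of k k'] by blast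
  qed
  have zero: "M 0 k = 0" "M i 0 = 0" for i k using supp by auto
  show "k < m \<Longrightarrow> \<Gamma> 0 k = \<Gamma> 0 (Suc k) \<longleftrightarrow> (\<exists>i. M i (Suc k) \<noteq> 0)"
    using cols[of k 0] zero by (metis gr0I le0)
  show "i < n \<Longrightarrow> \<Gamma> i 0 = \<Gamma> (Suc i) 0 \<longleftrightarrow> (\<exists>k. M (Suc i) k \<noteq> 0)"
    using rows[of i 0] zero by (metis gr0I le0)
  have entries: "M i k \<in> {1, -1, 0}" for i k
  proof (cases "i \<in> {1..n} \<and> k \<in> {1..m}")
    case True
    then show ?thesis using local_rule_entry[OF D(4)[of "i - 1" "k - 1"]] by auto
  qed (use supp in simp)
  have "k = k'" if "M i k \<noteq> 0" "M i k' \<noteq> 0" for i k k'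
  proof -
    have "i \<in> {1..n}" using that supp by blast
    then show ?thesis using rows[of "i - 1" k k'] that by auto
  qed
  moreover have "i = i'" if "M i k \<noteq> 0" "M i' k \<noteq> 0" for i i' k
  proof -
    have "k \<in> {1..m}" using that supp by blast
    then show ?thesis using cols[of "k - 1" i i'] that by auto
  qed
  ultimately show "M \<in> PPM n m (card {(i, k). M i k \<noteq> 0})"
    unfolding PPM_def using entries supp by blast
qed

section \<open>The bijection\<close>

lemma growth_array_iff:
  "growth_array n m \<alpha> \<beta> \<mu> U V M \<Gamma> \<longleftrightarrow>
     (\<forall>i k. i \<le> n \<and> k \<le> m \<longrightarrow> is_partition (\<Gamma> i k)) \<and>
     (\<forall>i k. \<not> (i \<le> n \<and> k \<le> m) \<longrightarrow> \<Gamma> i k = {}) \<and>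
     domino_multichain \<mu> \<beta> m {k. \<exists>i. M i k \<noteq> 0} U (\<lambda>k. \<Gamma> 0 k) \<and>
     domino_multichain \<mu> \<alpha> n {i. \<exists>k. M i k \<noteq> 0} V (\<lambda>i. \<Gamma> i 0) \<and>
     (\<forall>i<n. \<forall>k<m.
        local_rule (M (Suc i) (Suc k)) (\<Gamma> i k) (\<Gamma> i (Suc k)) (\<Gamma> (Suc i) k) (\<Gamma> (Suc i) (Suc k)))"
proof -
  have "(\<forall>i\<in>{1..n}. \<forall>k\<in>{1..m}. local_rule (M i k) (\<Gamma> (i - 1) (k - 1)) (\<Gamma> (i - 1) k) (\<Gamma> i (k - 1)) (\<Gamma> i k))
    \<longleftrightarrow> (\<forall>i<n. \<forall>k<m. local_rule (M (Suc i) (Suc k)) (\<Gamma> i k) (\<Gamma> i (Suc k)) (\<Gamma> (Suc i) k) (\<Gamma> (Suc i) (Suc k)))"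
    by (subst ball_shift[of n "\<lambda>i' i. \<forall>k\<in>{1..m}. local_rule (M i k) (\<Gamma> i' (k - 1)) (\<Gamma> i' k) (\<Gamma> i (k - 1)) (\<Gamma> i k)"],
        subst ball_shift[of m "\<lambda>k' k. local_rule (M (Suc i) k) (\<Gamma> i k') (\<Gamma> i k) (\<Gamma> (Suc i) k') (\<Gamma> (Suc i) k)" for i]) (rule refl)
  then show ?thesis unfolding growth_array_def by simp
qed

lemma growth_arrayD:
  assumes "growth_array n m \<alpha> \<beta> \<mu> U V M \<Gamma>"
  shows "i \<le> n \<Longrightarrow> k \<le> m \<Longrightarrow> is_partition (\<Gamma> i k)"
    and "\<not> (i \<le> n \<and> k \<le> m) \<Longrightarrow> \<Gamma> i k = {}"
    and "domino_multichain \<mu> \<beta> m {k. \<exists>i. M i k \<noteq> 0} U (\<lambda>k. \<Gamma> 0 k)"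
    and "domino_multichain \<mu> \<alpha> n {i. \<exists>k. M i k \<noteq> 0} V (\<lambda>i. \<Gamma> i 0)"
    and "i < n \<Longrightarrow> k < m \<Longrightarrow>
      local_rule (M (Suc i) (Suc k)) (\<Gamma> i k) (\<Gamma> i (Suc k)) (\<Gamma> (Suc i) k) (\<Gamma> (Suc i) (Suc k))"
  using assms unfolding growth_array_iff by simp_all

lemma domino_multichainD:
  assumes "domino_multichain mu l N Z T C"
  shows "C 0 = mu" "C N = l" "k < N \<Longrightarrow> C k \<le>\<^sub>d C (Suc k)" "k < N \<Longrightarrow> C k = C (Suc k) \<longleftrightarrow> Suc k \<in> Z"
  using assms unfolding domino_multichain_Suc by simp_all

text \<open>No nonzero entry lies below row \<open>n\<close> or to the right of column
  \<open>m\<close>, so by the invariant no trivial step survives on these borders.\<close>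

lemma growth_array_strict:
  assumes M: "M \<in> PPM n m j" and g: "growth_array n m \<alpha> \<beta> \<mu> U V M \<Gamma>"
  shows "growth_diagram n m M \<Gamma>"
    and "k < m \<Longrightarrow> \<Gamma> n k <\<^sub>d \<Gamma> n (Suc k)"
    and "i < n \<Longrightarrow> \<Gamma> i m <\<^sub>d \<Gamma> (Suc i) m"
    and "\<Gamma> 0 0 = \<mu>" "\<Gamma> 0 m = \<beta>" "\<Gamma> n 0 = \<alpha>"
proof -
  note G = growth_arrayD[OF g]
  note U = domino_multichainD[OF G(3)] and V = domino_multichainD[OF G(4)]
  show ends: "\<Gamma> 0 0 = \<mu>" "\<Gamma> 0 m = \<beta>" "\<Gamma> n 0 = \<alpha>" using U(1,2) V(2) by auto
  have corner: "is_partition (\<Gamma> 0 0)" using G(1) by simp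
  have top: "\<Gamma> 0 k \<le>\<^sub>d \<Gamma> 0 (Suc k) \<and> (\<Gamma> 0 k = \<Gamma> 0 (Suc k) \<longleftrightarrow> (\<exists>i. M i (Suc k) \<noteq> 0))" if "k < m" for k
    using U(3,4)[OF that] by simp
  have left: "\<Gamma> i 0 \<le>\<^sub>d \<Gamma> (Suc i) 0 \<and> (\<Gamma> i 0 = \<Gamma> (Suc i) 0 \<longleftrightarrow> (\<exists>k. M (Suc i) k \<noteq> 0))" if "i < n" for i
    using V(3,4)[OF that] by simp
  note inv = growth_invariant[where \<Gamma> = \<Gamma>, OF M corner top left G(5)]
  show gd: "growth_diagram n m M \<Gamma>" by (rule inv(1))
  have "\<not> (\<exists>i'>n. M i' (Suc k) \<noteq> 0)" "\<not> (\<exists>k'>m. M (Suc i) k' \<noteq> 0)" for i k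
    using PPMD(2)[OF M] by (metis atLeastAtMost_iff not_le)+
  then show "k < m \<Longrightarrow> \<Gamma> n k <\<^sub>d \<Gamma> n (Suc k)" "i < n \<Longrightarrow> \<Gamma> i m <\<^sub>d \<Gamma> (Suc i) m"
    using growth_diagramD(2)[OF gd, of n k] growth_diagramD(3)[OF gd, of i m] inv(2)[of n k] inv(3)[of i m]
    by (auto simp: le_d_def)
qed

text \<open>The array is filled by \<open>SOME\<close> before any rule is known to apply;
  \<open>growth_invariant\<close> shows afterwards that every choice was possible.\<close>

lemma growth_array_exists:
  assumes "skew_of_size \<beta> \<mu> (2 * (m - j))" "skew_of_size \<alpha> \<mu> (2 * (n - j))"
    and "U \<in> SDT \<beta> \<mu>" "V \<in> SDT \<alpha> \<mu>" and M: "M \<in> PPM n m j"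
  shows "\<exists>\<Gamma>. growth_array n m \<alpha> \<beta> \<mu> U V M \<Gamma>"
proof -
  let ?K = "{k. \<exists>i. M i k \<noteq> 0}" and ?I = "{i. \<exists>k. M i k \<noteq> 0}"
  obtain A where A: "domino_multichain \<mu> \<beta> m ?K U A"
    using SDT_multichain_exists[OF assms(3)] assms(1) PPM_card_trivial_steps[OF M] by metis
  obtain B where B: "domino_multichain \<mu> \<alpha> n ?I V B"
    using SDT_multichain_exists[OF assms(4)] assms(2) PPM_card_trivial_steps[OF M] by metis
  have "A 0 = B 0" using A B by (simp add: domino_multichain_def)
  then obtain H where H: "\<And>k. H 0 k = A k" "\<And>i. H i 0 = B i"
    "\<And>i k. H (Suc i) (Suc k) = (SOME \<tau>. local_rule (M (Suc i) (Suc k)) (H i k) (H i (Suc k)) (H (Suc i) k) \<tau>)"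
    using grid_recursion[where f = "\<lambda>i k \<nu> \<kappa> \<rho>. SOME \<tau>. local_rule (M (Suc i) (Suc k)) \<nu> \<kappa> \<rho> \<tau>"] by metis
  define \<Gamma> where "\<Gamma> i k = (if i \<le> n \<and> k \<le> m then H i k else {})" for i k
  have "is_partition (H 0 0)" using H(1) A assms(1) by (simp add: domino_multichain_def skew_of_size_def)
  note inv = growth_invariant(1)[where \<Gamma> = H, OF M this]
  have gd: "growth_diagram n m M H"
  proof (rule inv)
    show "H 0 k \<le>\<^sub>d H 0 (Suc k) \<and> (H 0 k = H 0 (Suc k) \<longleftrightarrow> (\<exists>i. M i (Suc k) \<noteq> 0))" if "k < m" for k
      using A that unfolding domino_multichain_Suc H by blast
    show "H i 0 \<le>\<^sub>d H (Suc i) 0 \<and> (H i 0 = H (Suc i) 0 \<longleftrightarrow> (\<exists>k. M (Suc i) k \<noteq> 0))" if "i < n" for i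
      using B that unfolding domino_multichain_Suc H by blast
    show "local_rule (M (Suc i) (Suc k)) (H i k) (H i (Suc k)) (H (Suc i) k) (H (Suc i) (Suc k))"
      if "local_rule (M (Suc i) (Suc k)) (H i k) (H i (Suc k)) (H (Suc i) k) \<tau>" for i k \<tau>
      unfolding H(3) using that by (rule someI)
  qed
  have "domino_multichain \<mu> \<beta> m ?K U (\<lambda>k. \<Gamma> 0 k)" "domino_multichain \<mu> \<alpha> n ?I V (\<lambda>i. \<Gamma> i 0)"
    using A B unfolding domino_multichain_Suc by (auto simp: \<Gamma>_def H)
  moreover have "is_partition (\<Gamma> i k)" if "i \<le> n" "k \<le> m" for i k
    using growth_diagramD(1)[OF gd that] that by (simp add: \<Gamma>_def)
  moreover have "\<Gamma> i k = {}" if "\<not> (i \<le> n \<and> k \<le> m)" for i k using that by (auto simp: \<Gamma>_def)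
  moreover have "local_rule (M (Suc i) (Suc k)) (\<Gamma> i k) (\<Gamma> i (Suc k)) (\<Gamma> (Suc i) k) (\<Gamma> (Suc i) (Suc k))"
    if "i < n" "k < m" for i k
    using growth_diagramD(4)[OF gd that] that by (simp add: \<Gamma>_def)
  ultimately have "growth_array n m \<alpha> \<beta> \<mu> U V M \<Gamma>"
    unfolding growth_array_iff by simp
  then show ?thesis by blast
qed

lemma growth_array_unique:
  assumes M: "M \<in> PPM n m j"
    and g: "growth_array n m \<alpha> \<beta> \<mu> U V M \<Gamma>" "growth_array n m \<alpha> \<beta> \<mu> U V M \<Gamma>'"
  shows "\<Gamma> = \<Gamma>'"
proof (intro ext)
  fix i k
  note G = g[unfolded growth_array_def]
  show "\<Gamma> i k = \<Gamma>' i k"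
  proof (cases "i \<le> n \<and> k \<le> m")
    case True
    have "\<Gamma> 0 k = \<Gamma>' 0 k" if "k \<le> m" for k
      using domino_multichain_unique[of \<mu> \<beta> m _ U "\<Gamma> 0" \<beta> "\<Gamma>' 0" k] G that by blast
    moreover have "\<Gamma> i 0 = \<Gamma>' i 0" if "i \<le> n" for i
      using domino_multichain_unique[of \<mu> \<alpha> n _ V "\<lambda>i. \<Gamma> i 0" \<alpha> "\<lambda>i. \<Gamma>' i 0" i] G that by blast
    ultimately show ?thesis
      using growth_diagram_forward_unique[OF growth_array_strict(1)[OF M g(1)] growth_array_strict(1)[OF M g(2)]]
        True by blast
  next
    case False
    then show ?thesis using G by simp
  qed
qed

text \<open>Without trivial steps the labels are the step numbers, so the conditions on
  \<open>P\<close> and \<open>Q\<close> in \<open>Phi_graph\<close> express multichains.\<close>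

lemma strict_multichain_iff:
  assumes "\<forall>k<N. C k <\<^sub>d C (Suc k)"
  shows "domino_multichain (C 0) (C N) N {} T C \<longleftrightarrow> (\<forall>k\<in>{1..N}. domino_of T k = C k - C (k - 1))"
proof -
  have "C (k - 1) <\<^sub>d C k" if "k \<in> {1..N}" for k using assms that by (cases k) auto
  moreover from this have "C (k - 1) \<noteq> C k" if "k \<in> {1..N}" for k using that less_d_irrefl by metis
  ultimately show ?thesis by (auto simp: domino_multichain_def le_d_def)
qed

lemma strict_multichain_SDT:
  assumes "is_partition (C 0)" "\<forall>k<N. C k <\<^sub>d C (Suc k)"
  shows "skew_of_size (C N) (C 0) (2 * N)"
    and "\<exists>!T. T \<in> SDT (C N) (C 0) \<and> (\<forall>k\<in>{1..N}. domino_of T k = C k - C (k - 1))"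
proof -
  have "\<forall>k<N. C k \<noteq> C (Suc k)" using assms(2) less_d_irrefl by metis
  then obtain T where T: "T \<in> SDT (C N) (C 0)" "domino_multichain (C 0) (C N) N {} T C"
    "skew_of_size (C N) (C 0) (2 * card ({1..N} - {}))"
    using multichain_SDT_exists[of C N "{}"] assms by (auto simp: le_d_def)
  then show "skew_of_size (C N) (C 0) (2 * N)" by simp
  show "\<exists>!T. T \<in> SDT (C N) (C 0) \<and> (\<forall>k\<in>{1..N}. domino_of T k = C k - C (k - 1))"
    unfolding strict_multichain_iff[OF assms(2), symmetric]
    using T domino_multichain_SDT_unique[OF _ _ _ _ T(3)] by blast
qed

lemma Phi_graph_total:
  assumes x: "x \<in> Phi_dom \<alpha> \<beta> n m"
  shows "\<exists>!y. Phi_graph \<alpha> \<beta> n m x y" "Phi_graph \<alpha> \<beta> n m x y \<Longrightarrow> y \<in> Phi_cod \<alpha> \<beta> n m"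
proof -
  obtain j \<mu> U V M where x_eq: "x = (U, V, M)" and
    d: "skew_of_size \<beta> \<mu> (2 * (m - j))" "skew_of_size \<alpha> \<mu> (2 * (n - j))"
    "U \<in> SDT \<beta> \<mu>" "V \<in> SDT \<alpha> \<mu>" "M \<in> PPM n m j"
    using x by (auto simp: Phi_dom_def)
  obtain \<Gamma> where g: "growth_array n m \<alpha> \<beta> \<mu> U V M \<Gamma>" using growth_array_exists[OF d] ..
  note s = growth_array_strict[OF d(5) g]
  have part: "is_partition (\<Gamma> n 0)" "is_partition (\<Gamma> 0 m)" using growth_diagramD(1)[OF s(1)] by auto
  have "\<forall>k<m. \<Gamma> n k <\<^sub>d \<Gamma> n (Suc k)" "\<forall>i<n. \<Gamma> i m <\<^sub>d \<Gamma> (Suc i) m" using s by auto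
  note P = strict_multichain_SDT[OF part(1) this(1), unfolded s]
    and Q = strict_multichain_SDT[of "\<lambda>i. \<Gamma> i m", OF part(2) this(2), unfolded s]
  \<comment> \<open>\<open>Phi_graph\<close> quantifies \<mu> existentially; the support of
    \<open>U\<close> is \<beta> - \<mu>, which recovers it.\<close>
  have \<mu>: "\<mu>' = \<mu>" if "U \<in> SDT \<beta> \<mu>'" for \<mu>'
  proof -
    have "\<beta> - \<mu>' = \<beta> - \<mu>" using SDT_support[OF that] SDT_support[OF d(3)] by blast
    moreover have "\<mu>' \<subseteq> \<beta>" "\<mu> \<subseteq> \<beta>"
      using SDT_skew[OF that] SDT_skew[OF d(3)] by (auto simp: skew_of_size_def)
    ultimately show ?thesis by blast
  qed
  have graph: "Phi_graph \<alpha> \<beta> n m x (P, Q) \<longleftrightarrow>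
    (P \<in> SDT (\<Gamma> n m) \<alpha> \<and> (\<forall>k \<in> {1..m}. domino_of P k = \<Gamma> n k - \<Gamma> n (k - 1))) \<and>
    (Q \<in> SDT (\<Gamma> n m) \<beta> \<and> (\<forall>i \<in> {1..n}. domino_of Q i = \<Gamma> i m - \<Gamma> (i - 1) m))"
    (is "_ \<longleftrightarrow> ?R P Q") for P Q
  proof
    assume "Phi_graph \<alpha> \<beta> n m x (P, Q)"
    then obtain \<mu>' \<Gamma>' where g': "U \<in> SDT \<beta> \<mu>'" "growth_array n m \<alpha> \<beta> \<mu>' U V M \<Gamma>'"
      and PQ: "P \<in> SDT (\<Gamma>' n m) \<alpha>" "\<forall>k \<in> {1..m}. domino_of P k = \<Gamma>' n k - \<Gamma>' n (k - 1)"
        "Q \<in> SDT (\<Gamma>' n m) \<beta>" "\<forall>i \<in> {1..n}. domino_of Q i = \<Gamma>' i m - \<Gamma>' (i - 1) m"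
      unfolding Phi_graph_def x_eq by auto
    have "\<Gamma>' = \<Gamma>" using growth_array_unique[OF d(5) g'(2)[unfolded \<mu>[OF g'(1)]] g] .
    then show "?R P Q" using PQ by simp
  next
    assume "?R P Q"
    then show "Phi_graph \<alpha> \<beta> n m x (P, Q)" unfolding Phi_graph_def x_eq using d(3,4) g by auto
  qed
  obtain P' Q' where "Phi_graph \<alpha> \<beta> n m x (P', Q')" using P(2) Q(2) unfolding graph by blast
  moreover have "y = (P', Q')" if "Phi_graph \<alpha> \<beta> n m x y" for y
    using that calculation P(2) Q(2) by (cases y) (simp only: graph, blast)
  ultimately show "\<exists>!y. Phi_graph \<alpha> \<beta> n m x y" by blast
  show "y \<in> Phi_cod \<alpha> \<beta> n m" if "Phi_graph \<alpha> \<beta> n m x y"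
    using that graph P(1) Q(1) by (cases y) (auto simp: Phi_cod_def)
qed

text \<open>\<open>P\<close> and \<open>Q\<close> rebuild the bottom row from \<alpha> and the right
  column from \<beta>. Backward uniqueness then gives the array and the matrix, and the other two
  borders give \<open>U\<close> and \<open>V\<close>.\<close>

lemma Phi_graph_inj:
  assumes x: "x \<in> Phi_dom \<alpha> \<beta> n m" "x' \<in> Phi_dom \<alpha> \<beta> n m"
    and y: "Phi_graph \<alpha> \<beta> n m x y" "Phi_graph \<alpha> \<beta> n m x' y"
  shows "x = x'"
proof -
  obtain j U V M j' U' V' M' where eqs: "x = (U, V, M)" "x' = (U', V', M')"
    and M: "M \<in> PPM n m j" and M': "M' \<in> PPM n m j'"
    using x by (auto simp: Phi_dom_def)
  obtain P Q where y_eq: "y = (P, Q)" by (cases y)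
  obtain \<mu> \<Gamma> where g: "U \<in> SDT \<beta> \<mu>" "V \<in> SDT \<alpha> \<mu>" "growth_array n m \<alpha> \<beta> \<mu> U V M \<Gamma>"
    and PQ: "\<forall>k \<in> {1..m}. domino_of P k = \<Gamma> n k - \<Gamma> n (k - 1)"
      "\<forall>i \<in> {1..n}. domino_of Q i = \<Gamma> i m - \<Gamma> (i - 1) m"
    using y(1) unfolding eqs y_eq Phi_graph_def by auto
  obtain \<mu>' \<Gamma>' where g': "U' \<in> SDT \<beta> \<mu>'" "V' \<in> SDT \<alpha> \<mu>'" "growth_array n m \<alpha> \<beta> \<mu>' U' V' M' \<Gamma>'"
    and PQ': "\<forall>k \<in> {1..m}. domino_of P k = \<Gamma>' n k - \<Gamma>' n (k - 1)"
      "\<forall>i \<in> {1..n}. domino_of Q i = \<Gamma>' i m - \<Gamma>' (i - 1) m"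
    using y(2) unfolding eqs y_eq Phi_graph_def by auto
  note s = growth_array_strict[OF M g(3)] and s' = growth_array_strict[OF M' g'(3)]
  have bottom: "\<Gamma> n k = \<Gamma>' n k" if "k \<le> m" for k
    using domino_multichain_unique[OF strict_multichain_iff[of m "\<Gamma> n" P, THEN iffD2, OF _ PQ(1), unfolded s(6)]
        strict_multichain_iff[of m "\<Gamma>' n" P, THEN iffD2, OF _ PQ'(1), unfolded s'(6)] that] s(2) s'(2) by blast
  have right: "\<Gamma> i m = \<Gamma>' i m" if "i \<le> n" for i
    using domino_multichain_unique[OF
        strict_multichain_iff[of n "\<lambda>i. \<Gamma> i m" Q, THEN iffD2, OF _ PQ(2), unfolded s(5)]
        strict_multichain_iff[of n "\<lambda>i. \<Gamma>' i m" Q, THEN iffD2, OF _ PQ'(2), unfolded s'(5)] that] s(3) s'(3)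
    by blast
  note eq = growth_diagram_backward_unique[OF s(1) s'(1) bottom right]
  have M_eq: "M = M'"
  proof (intro ext)
    fix i k
    show "M i k = M' i k"
    proof (cases "i \<in> {1..n} \<and> k \<in> {1..m}")
      case True
      then show ?thesis using eq(2)[of "i - 1" "k - 1"] by auto
    next
      case False
      then show ?thesis using PPMD(2)[OF M, of i k] PPMD(2)[OF M', of i k] by metis
    qed
  qed
  have "\<Gamma> = \<Gamma>'"
  proof (intro ext)
    fix i k
    show "\<Gamma> i k = \<Gamma>' i k"
      using eq(1)[of i k] g(3) g'(3) unfolding growth_array_def by (cases "i \<le> n \<and> k \<le> m") auto
  qed
  moreover from this have \<mu>_eq: "\<mu> = \<mu>'" using s(4) s'(4) by simp
  ultimately have chains:
    "domino_multichain \<mu> \<beta> m {k. \<exists>i. M i k \<noteq> 0} U (\<lambda>k. \<Gamma> 0 k)"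
    "domino_multichain \<mu> \<beta> m {k. \<exists>i. M i k \<noteq> 0} U' (\<lambda>k. \<Gamma> 0 k)"
    "domino_multichain \<mu> \<alpha> n {i. \<exists>k. M i k \<noteq> 0} V (\<lambda>i. \<Gamma> i 0)"
    "domino_multichain \<mu> \<alpha> n {i. \<exists>k. M i k \<noteq> 0} V' (\<lambda>i. \<Gamma> i 0)"
    using g(3) g'(3) M_eq unfolding growth_array_def by simp_all
  have part: "is_partition (\<Gamma> 0 0)" using growth_diagramD(1)[OF s(1)] by simp
  \<comment> \<open>The number of dominoes is taken from the border chains themselves, which the two
    arrays now share.\<close>
  have sizes: "skew_of_size \<beta> \<mu> (2 * card ({1..m} - {k. \<exists>i. M i k \<noteq> 0}))"
    "skew_of_size \<alpha> \<mu> (2 * card ({1..n} - {i. \<exists>k. M i k \<noteq> 0}))"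
    using multichain_SDT_exists[of "\<Gamma> 0" m "{k. \<exists>i. M i k \<noteq> 0}"]
      multichain_SDT_exists[of "\<lambda>i. \<Gamma> i 0" n "{i. \<exists>k. M i k \<noteq> 0}"] part chains(1,3)
    unfolding domino_multichain_Suc by auto
  have "U = U'"
    by (rule domino_multichain_SDT_unique[OF chains(1,2) g(1) _ sizes(1)]) (use g'(1) \<mu>_eq in simp)
  moreover have "V = V'"
    by (rule domino_multichain_SDT_unique[OF chains(3,4) g(2) _ sizes(2)]) (use g'(2) \<mu>_eq in simp)
  ultimately show ?thesis using M_eq eqs by simp
qed

lemma Phi_graph_surj:
  assumes "y \<in> Phi_cod \<alpha> \<beta> n m"
  shows "\<exists>x \<in> Phi_dom \<alpha> \<beta> n m. Phi_graph \<alpha> \<beta> n m x y"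
proof -
  obtain P Q l where y: "y = (P, Q)" "skew_of_size l \<alpha> (2 * m)" "skew_of_size l \<beta> (2 * n)"
    "P \<in> SDT l \<alpha>" "Q \<in> SDT l \<beta>" using assms by (auto simp: Phi_cod_def)
  obtain B where B: "domino_multichain \<alpha> l m {} P B"
    using SDT_multichain_exists[OF y(4), of m "{}"] y(2) by auto
  obtain R where R: "domino_multichain \<beta> l n {} Q R"
    using SDT_multichain_exists[OF y(5), of n "{}"] y(3) by auto
  note B' = domino_multichainD[OF B] and R' = domino_multichainD[OF R]
  have "is_partition (B m)" "B m = R n" using B'(2) R'(2) y(2) by (auto simp: skew_of_size_def)
  then obtain M \<Gamma> where g: "growth_diagram n m M \<Gamma>" and
    bottom: "\<And>k. k \<le> m \<Longrightarrow> \<Gamma> n k = B k" and right: "\<And>i. i \<le> n \<Longrightarrow> \<Gamma> i m = R i" and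
    supp: "\<And>i k. \<not> (i \<in> {1..n} \<and> k \<in> {1..m}) \<Longrightarrow> M i k = 0"
      "\<And>i k. \<not> (i \<le> n \<and> k \<le> m) \<Longrightarrow> \<Gamma> i k = {}"
    using growth_diagram_backward_exists[of B m n R] B'(3) R'(3) by blast
  note D = growth_diagramD[OF g]
  \<comment> \<open>The chains of \<open>P\<close> and \<open>Q\<close> were taken with
    \<open>Z\<close> empty, which provides the strict borders that make \<open>M\<close> a partial
    permutation matrix.\<close>
  have strict: "\<Gamma> n k \<noteq> \<Gamma> n (Suc k)" if "k < m" for k using bottom[of k] bottom[of "Suc k"] B'(4) that by simp
  have strict': "\<Gamma> i m \<noteq> \<Gamma> (Suc i) m" if "i < n" for i using right[of i] right[of "Suc i"] R'(4) that by simp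
  obtain j where p: "M \<in> PPM n m j" "\<And>k. k < m \<Longrightarrow> \<Gamma> 0 k = \<Gamma> 0 (Suc k) \<longleftrightarrow> (\<exists>i. M i (Suc k) \<noteq> 0)"
    "\<And>i. i < n \<Longrightarrow> \<Gamma> i 0 = \<Gamma> (Suc i) 0 \<longleftrightarrow> (\<exists>k. M (Suc i) k \<noteq> 0)"
    using growth_diagram_strict_PPM[OF g supp(1) strict strict'] by blast
  let ?K = "{k. \<exists>i. M i k \<noteq> 0}" and ?I = "{i. \<exists>k. M i k \<noteq> 0}"
  have ends: "\<Gamma> n m = l" "\<Gamma> n 0 = \<alpha>" "\<Gamma> 0 m = \<beta>"
    using bottom[of m] bottom[of 0] right[of 0] B'(1,2) R'(1) by auto
  obtain U where U: "U \<in> SDT \<beta> (\<Gamma> 0 0)" "domino_multichain (\<Gamma> 0 0) \<beta> m ?K U (\<Gamma> 0)"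
    "skew_of_size \<beta> (\<Gamma> 0 0) (2 * (m - j))"
    using multichain_SDT_exists[of "\<Gamma> 0" m ?K, unfolded PPM_card_trivial_steps[OF p(1)] ends]
      D(1)[of 0 0] D(2)[of 0] p(2) by auto
  obtain V where V: "V \<in> SDT \<alpha> (\<Gamma> 0 0)" "domino_multichain (\<Gamma> 0 0) \<alpha> n ?I V (\<lambda>i. \<Gamma> i 0)"
    "skew_of_size \<alpha> (\<Gamma> 0 0) (2 * (n - j))"
    using multichain_SDT_exists[of "\<lambda>i. \<Gamma> i 0" n ?I, unfolded PPM_card_trivial_steps[OF p(1)] ends]
      D(1)[of 0 0] D(3)[of _ 0] p(3) by auto
  have array: "growth_array n m \<alpha> \<beta> (\<Gamma> 0 0) U V M \<Gamma>"
    unfolding growth_array_iff using D(1,4) supp(2) U(2) V(2) by blast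
  have "domino_of P k = \<Gamma> n k - \<Gamma> n (k - 1)" if "k \<in> {1..m}" for k
  proof -
    have "k \<le> m" "k - 1 \<le> m" using that by auto
    from bottom[OF this(1)] bottom[OF this(2)] show ?thesis using B that by (simp add: domino_multichain_def)
  qed
  moreover have "domino_of Q i = \<Gamma> i m - \<Gamma> (i - 1) m" if "i \<in> {1..n}" for i
  proof -
    have "i \<le> n" "i - 1 \<le> n" using that by auto
    from right[OF this(1)] right[OF this(2)] show ?thesis using R that by (simp add: domino_multichain_def)
  qed
  ultimately have "Phi_graph \<alpha> \<beta> n m (U, V, M) y"
    unfolding Phi_graph_def y(1) using U(1) V(1) array y(4,5) ends(1) by auto
  moreover have "(U, V, M) \<in> Phi_dom \<alpha> \<beta> n m"
    unfolding Phi_dom_def using U(1,3) V(1,3) p(1) by blast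
  ultimately show ?thesis by blast
qed

text \<open>The first two conjuncts express that \<Phi> is well defined: the array exists uniquely,
  and so does the pair of tableaux, which gives the \<open>THE\<close> in \<open>Phi\<close> its
  meaning.\<close>

theorem theorem3p3:
  fixes \<alpha> \<beta> :: diagram and n m :: nat
  assumes "is_partition \<alpha>" and "is_partition \<beta>"
  shows "(\<forall>j \<mu> U V M.
            skew_of_size \<beta> \<mu> (2 * (m - j)) \<and> skew_of_size \<alpha> \<mu> (2 * (n - j)) \<and>
            U \<in> SDT \<beta> \<mu> \<and> V \<in> SDT \<alpha> \<mu> \<and> M \<in> PPM n m j \<longrightarrow>
            (\<exists>!\<Gamma>. growth_array n m \<alpha> \<beta> \<mu> U V M \<Gamma>)) \<and>
         (\<forall>x \<in> Phi_dom \<alpha> \<beta> n m. \<exists>!y. Phi_graph \<alpha> \<beta> n m x y) \<and>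
         bij_betw (Phi \<alpha> \<beta> n m) (Phi_dom \<alpha> \<beta> n m) (Phi_cod \<alpha> \<beta> n m)"
proof (intro conjI)
  show "\<forall>j \<mu> U V M.
    skew_of_size \<beta> \<mu> (2 * (m - j)) \<and> skew_of_size \<alpha> \<mu> (2 * (n - j)) \<and>
    U \<in> SDT \<beta> \<mu> \<and> V \<in> SDT \<alpha> \<mu> \<and> M \<in> PPM n m j \<longrightarrow>
    (\<exists>!\<Gamma>. growth_array n m \<alpha> \<beta> \<mu> U V M \<Gamma>)"
    using growth_array_exists growth_array_unique by metis
  show "\<forall>x \<in> Phi_dom \<alpha> \<beta> n m. \<exists>!y. Phi_graph \<alpha> \<beta> n m x y" using Phi_graph_total(1) by blast
  have graph: "Phi_graph \<alpha> \<beta> n m x (Phi \<alpha> \<beta> n m x)" if "x \<in> Phi_dom \<alpha> \<beta> n m" for x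
    unfolding Phi_def using Phi_graph_total(1)[OF that] by (rule theI')
  show "bij_betw (Phi \<alpha> \<beta> n m) (Phi_dom \<alpha> \<beta> n m) (Phi_cod \<alpha> \<beta> n m)"
  proof (rule bij_betw_imageI)
    show "inj_on (Phi \<alpha> \<beta> n m) (Phi_dom \<alpha> \<beta> n m)"
    proof (rule inj_onI)
      fix x x' assume x: "x \<in> Phi_dom \<alpha> \<beta> n m" "x' \<in> Phi_dom \<alpha> \<beta> n m"
        and eq: "Phi \<alpha> \<beta> n m x = Phi \<alpha> \<beta> n m x'"
      show "x = x'" using Phi_graph_inj[OF x graph[OF x(1)]] graph[OF x(2)] eq by simp
    qed
    have "y \<in> Phi \<alpha> \<beta> n m ` Phi_dom \<alpha> \<beta> n m" if y: "y \<in> Phi_cod \<alpha> \<beta> n m" for y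
    proof -
      obtain x where x: "x \<in> Phi_dom \<alpha> \<beta> n m" "Phi_graph \<alpha> \<beta> n m x y"
        using Phi_graph_surj[OF y] by blast
      then have "Phi \<alpha> \<beta> n m x = y" using Phi_graph_total(1)[OF x(1)] graph[OF x(1)] by blast
      then show ?thesis using x(1) by blast
    qed
    then show "Phi \<alpha> \<beta> n m ` Phi_dom \<alpha> \<beta> n m = Phi_cod \<alpha> \<beta> n m"
      using graph Phi_graph_total(2) by blast
  qed
qed

end
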